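(* Let $(X,T,\mu,\alpha)$ be a mixing Gibbs--Markov map with full branches and potential $\varphi$, let $G$ be an amenable finitely generated group, let $\psi:X\to G$ be constant on each $a\in\alpha$, and assume that the group extension $T_\psi$ of $T$ is topologically transitive. Then $$P_\varphi(T_\psi)=P_\varphi(T_\psi^{\rm ab}).$$ Moreover, there exists a subsequence $(m_{n_i})_i$ of the sequence of measures $(m_n)$ on $G$ defined in the context such that $$P_\varphi(T_\psi)=\lim_{i\to\infty}\frac1{n_i}\log\lambda(G,m_{n_i})+P_\varphi(T).$$
   Context: **Gibbs--Markov (GM) maps.** $(X,\mu)$ is a probability space, $T:X\to X$ is a topologically mixing, ergodic, $\mu$-preserving map which is mixing for $\mu$ and piecewise continuous with respect to a countable partition $\alpha$. For $n\ge1$, $\alpha_n=\bigvee_{j=0}^{n-1}T^{-j}\alpha$; its elements are called $n$-cylinders. For $x,x'\in X$, $s(x,x')$ is the least $n\ge0$ such that $T^nx,T^nx'$ lie in distinct elements of $\alpha$; one has $s(x,x')=\infty$ iff $x=x'$. For $\beta\in(0,1)$, $d_\beta(x,x')=\beta^{s(x,x')}$ is a metric on $X$, which gives the topology of $X$. The potential is $\varphi=\log\frac{d\mu}{d\mu\circ T}$ and $\varphi_n=\sum_{j=0}^{n-1}\varphi\circ T^j$. $T$ is Gibbs--Markov if: for each $a\in\alpha$, $T(a)$ is a union of elements of $\alpha$ mod $\mu$ and $T|_a:a\to T(a)$ is a measurable bijection; $\inf_{a\in\alpha}\mu(T(a))>0$; and there are $C>0$, $\beta\in(0,1)$ with $|\varphi(x)-\varphi(x')|\le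 C d_\beta(x,x')$ for all $x,x'\in a$, $a\in\alpha$. Full branches means $T(a)=X$ for each $a\in\alpha$. **Extensions.** $G$ is discrete with identity $e$. $\psi_n(x)=\psi(T^{n-1}x)\cdots\psi(Tx)\psi(x)$ (constant on $n$-cylinders $v$, with value $\psi_n(v)$) and $T_\psi:X\times G\to X\times G$, $T_\psi(x,g)=(Tx,\psi(x)g)$. Let $G^{\rm ab}=G/[G,G]$, let $G^{\rm ab}_T$ be its torsion subgroup, $\overline G=G^{\rm ab}/G^{\rm ab}_T\cong\mathbb{Z}^k$ ($k\ge0$), $\pi:G\to\overline G$ the canonical homomorphism, $\overline\psi=\pi\circ\psi$, $\overline\psi_n=\pi\circ\psi_n$, and $T_\psi^{\rm ab}:X\times\overline G\to X\times\overline G$, $T_\psi^{\rm ab}(x,m)=(Tx,m+\overline\psi(x))$. **Gurevič pressures.** For $a\in\alpha$, $g\in G$, $m\in\overline G$: $P_\varphi(T)=\limsup_{n}\frac1n\log\sum_{T^nx=x,\,x\in a}e^{\varphi_n(x)}$; $P_\varphi(T_\psi)=\limsup_n\frac1n\log\sum_{T^nx=x,\,x\in a,\,\psi_n(x)=g}e^{\varphi_n(x)}$; $P_\varphi(T_\psi^{\rm ab})=\limsup_n\frac1n\log\sum_{T^nx=x,\,x\in a,\,\overline\psi_n(x)=m}e^{\varphi_n(x)}$. Under the transitivity assumption these are understood not to depend on the choices of $a,g,m$. **Measures $m_n$.** Fix $m\in\mathbb{N}$, a cylinder $a\in\alpha_m$ and a point $\xi\in a$. For $n\ge m$ let $\alpha_n(a)=\{v\in\alpha_n: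 v\cap a=v\ \mathrm{mod}\ \mu,\ \mu(v\cap T^{-n}(a))>0\}$; for $v\in\alpha_n$ let $T_v^{-1}:T^n(v)\to v$ be the inverse of $T^n:v\to T^n(v)$. Put $P_n(1)=\sum_{v\in\alpha_n(a)}e^{\varphi_n(T_v^{-1}\xi)}$ and $$m_n(g)=\frac1{P_n(1)}\sum_{v\in\alpha_n(a),\,\psi_n(v)=g}e^{\varphi_n(T_v^{-1}\xi)},\quad g\in G,$$ a probability measure on $G$. **Spectral radius.** For a probability measure $\nu$ on $G$, $\lambda(G,\nu)=\limsup_{k\to\infty}(\nu^{*k}(e))^{1/k}$, where $\nu^{*k}$ is the $k$-th convolution power.
   Formalization: The formal theorem additionally assumes that X is complete for the metrics d_β (X is the whole full shift); otherwise periodic points may be missing from cylinders and the equality of pressures can fail, e.g. for a Heisenberg extension with a countable null set of orbits deleted. *)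

theory Defs
  imports "HOL-Probability.Probability" "HOL-Algebra.Generated_Groups"
begin

section \<open>Dynamics\<close>

definition topologically_mixing :: "'x topology \<Rightarrow> ('x \<Rightarrow> 'x) \<Rightarrow> bool" where
  "topologically_mixing X T \<longleftrightarrow>
    (\<forall>U V. openin X U \<and> U \<noteq> {} \<and> openin X V \<and> V \<noteq> {} \<longrightarrow>
      (\<exists>N. \<forall>n\<ge>N. (T ^^ n) ` U \<inter> V \<noteq> {}))"

definition topologically_transitive :: "'x topology \<Rightarrow> ('x \<Rightarrow> 'x) \<Rightarrow> bool" where
  "topologically_transitive X T \<longleftrightarrow>
    (\<forall>U V. openin X U \<and> U \<noteq> {} \<and> openin X V \<and> V \<noteq> {} \<longrightarrow>
      (\<exists>n. (T ^^ n) ` U \<inter> V \<noteq> {}))"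

definition ergodic_map :: "'x measure \<Rightarrow> ('x \<Rightarrow> 'x) \<Rightarrow> bool" where
  "ergodic_map M T \<longleftrightarrow>
    (\<forall>A\<in>sets M. T -` A \<inter> space M = A \<longrightarrow> measure M A = 0 \<or> measure M A = 1)"

definition mixing_map :: "'x measure \<Rightarrow> ('x \<Rightarrow> 'x) \<Rightarrow> bool" where
  "mixing_map M T \<longleftrightarrow>
    (\<forall>A\<in>sets M. \<forall>B\<in>sets M.
      (\<lambda>n. measure M (A \<inter> (T ^^ n) -` B)) \<longlonglongrightarrow> measure M A * measure M B)"

definition birkhoff_sum :: "('x \<Rightarrow> 'x) \<Rightarrow> ('x \<Rightarrow> real) \<Rightarrow> nat \<Rightarrow> 'x \<Rightarrow> real" where
  "birkhoff_sum T \<phi> n x = (\<Sum>j<n. \<phi> ((T ^^ j) x))"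

text \<open>The nonempty elements of the join of the partitions \<open>T\<^sup>-\<^sup>j \<alpha>\<close>, \<open>j < n\<close>.\<close>

definition cylinders :: "'x set \<Rightarrow> ('x \<Rightarrow> 'x) \<Rightarrow> 'x set set \<Rightarrow> nat \<Rightarrow> 'x set set" where
  "cylinders X T \<alpha> n =
    {v. v \<noteq> {} \<and> (\<exists>c. (\<forall>j<n. c j \<in> \<alpha>) \<and> v = {x \<in> X. \<forall>j<n. (T ^^ j) x \<in> c j})}"

text \<open>Note that \<open>Inf {} = \<infinity>\<close> in \<^typ>\<open>enat\<close>.\<close>

definition separation_time :: "('x \<Rightarrow> 'x) \<Rightarrow> 'x set set \<Rightarrow> 'x \<Rightarrow> 'x \<Rightarrow> enat" where
  "separation_time T \<alpha> x y =
    Inf {enat n | n. \<not> (\<exists>a\<in>\<alpha>. (T ^^ n) x \<in> a \<and> (T ^^ n) y \<in> a)}"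

definition separation_dist :: "('x \<Rightarrow> 'x) \<Rightarrow> 'x set set \<Rightarrow> real \<Rightarrow> 'x \<Rightarrow> 'x \<Rightarrow> real" where
  "separation_dist T \<alpha> \<beta> x y =
    (case separation_time T \<alpha> x y of enat n \<Rightarrow> \<beta> ^ n | \<infinity> \<Rightarrow> 0)"

text \<open>The measure \<open>\<mu> \<circ> T\<close> on a set \<open>a\<close> on which \<open>T\<close> is injective with measurable images.\<close>

definition measure_comp_on :: "'x measure \<Rightarrow> ('x \<Rightarrow> 'x) \<Rightarrow> 'x set \<Rightarrow> 'x measure" where
  "measure_comp_on M T a = measure_of a (sets (restrict_space M a)) (\<lambda>B. emeasure M (T ` B))"

text \<open>
  The potential \<open>\<phi> = log (d\<mu> / d(\<mu> \<circ> T))\<close> is a parameter, because the Lipschitz condition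
  singles out a version of the Radon-Nikodym derivative that is defined everywhere.
  Images of measurable sets are required to be measurable so that \<open>\<mu> \<circ> T\<close> makes sense.
\<close>

locale gibbs_markov = prob_space M for M :: "'x measure" +
  fixes T :: "'x \<Rightarrow> 'x" and \<alpha> :: "'x set set" and \<phi> :: "'x \<Rightarrow> real" and TX :: "'x topology"
  assumes partition: "partition_on (space M) \<alpha>" "countable \<alpha>" "\<alpha> \<subseteq> sets M"
    and separating: "\<And>x y. x \<in> space M \<Longrightarrow> y \<in> space M \<Longrightarrow>
      separation_time T \<alpha> x y = \<infinity> \<longleftrightarrow> x = y"
    and topology: "\<And>\<beta>. 0 < \<beta> \<Longrightarrow> \<beta> < 1 \<Longrightarrow>
      Metric_space.mtopology (space M) (separation_dist T \<alpha> \<beta>) = TX"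
    and T_measurable: "T \<in> measurable M M"
    and T_preserving: "distr M M T = M"
    and T_ergodic: "ergodic_map M T"
    and T_mixing: "mixing_map M T"
    and T_topologically_mixing: "topologically_mixing TX T"
    and T_continuous: "\<And>a. a \<in> \<alpha> \<Longrightarrow> continuous_map (subtopology TX a) TX T"
    and T_bij: "\<And>a. a \<in> \<alpha> \<Longrightarrow> bij_betw T a (T ` a)"
    and T_image_measurable: "\<And>a B. a \<in> \<alpha> \<Longrightarrow> B \<in> sets M \<Longrightarrow> B \<subseteq> a \<Longrightarrow> T ` B \<in> sets M"
    and T_markov: "\<And>a. a \<in> \<alpha> \<Longrightarrow> \<exists>\<B>\<subseteq>\<alpha>. emeasure M (sym_diff (T ` a) (\<Union>\<B>)) = 0"
    and T_big_images: "(INF a\<in>\<alpha>. measure M (T ` a)) > 0"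
    and potential_measurable: "\<phi> \<in> borel_measurable M"
    and potential: "\<And>a. a \<in> \<alpha> \<Longrightarrow>
      restrict_space M a = density (measure_comp_on M T a) (\<lambda>x. ennreal (exp (\<phi> x)))"
    and potential_lipschitz: "\<exists>C>0. \<exists>\<beta>. 0 < \<beta> \<and> \<beta> < 1 \<and>
      (\<forall>a\<in>\<alpha>. \<forall>x\<in>a. \<forall>y\<in>a. \<bar>\<phi> x - \<phi> y\<bar> \<le> C * separation_dist T \<alpha> \<beta> x y)"

definition full_branches :: "'x measure \<Rightarrow> ('x \<Rightarrow> 'x) \<Rightarrow> 'x set set \<Rightarrow> bool" where
  "full_branches M T \<alpha> \<longleftrightarrow> (\<forall>a\<in>\<alpha>. T ` a = space M)"

lemma separation_dist_metric:
  assumes part: "partition_on X \<alpha>" and T: "T \<in> X \<rightarrow> X"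
    and sep: "\<And>x y. x \<in> X \<Longrightarrow> y \<in> X \<Longrightarrow> separation_time T \<alpha> x y = \<infinity> \<longleftrightarrow> x = y"
    and b: "0 < \<beta>" "\<beta> < 1"
  shows "Metric_space X (separation_dist T \<alpha> \<beta>)"
proof
  fix x y
  show "0 \<le> separation_dist T \<alpha> \<beta> x y"
    using b by (auto simp: separation_dist_def split: enat.split)
  show "separation_dist T \<alpha> \<beta> x y = separation_dist T \<alpha> \<beta> y x"
    by (simp add: separation_dist_def separation_time_def conj_commute)
next
  fix x y assume "x \<in> X" "y \<in> X"
  then show "separation_dist T \<alpha> \<beta> x y = 0 \<longleftrightarrow> x = y"
    using b sep[of x y] by (auto simp: separation_dist_def split: enat.split)
next
  fix x y z assume X: "x \<in> X" "y \<in> X" "z \<in> X"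
  have orbit: "(T ^^ n) u \<in> X" if "u \<in> X" for n u
    using that T by (induction n) auto
  let ?D = "\<lambda>x y n. \<not> (\<exists>a\<in>\<alpha>. (T ^^ n) x \<in> a \<and> (T ^^ n) y \<in> a)"
  have D: "?D x y n \<or> ?D y z n" if "?D x z n" for n
  proof (rule ccontr)
    assume "\<not> (?D x y n \<or> ?D y z n)"
    then obtain a b where "a \<in> \<alpha>" "b \<in> \<alpha>" "(T ^^ n) x \<in> a" "(T ^^ n) y \<in> a" "(T ^^ n) y \<in> b" "(T ^^ n) z \<in> b"
      by blast
    moreover from this have "a = b" using part by (auto simp: partition_on_def disjoint_def)
    ultimately show False using that by blast
  qed
  have le: "separation_dist T \<alpha> \<beta> u v \<ge> \<beta> ^ n" if "?D u v n" for u v n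
  proof -
    have "separation_time T \<alpha> u v \<le> enat n"
      unfolding separation_time_def using that by (intro Inf_lower) auto
    then show ?thesis using b
      by (auto simp: separation_dist_def power_decreasing split: enat.split)
  qed
  have nonneg: "separation_dist T \<alpha> \<beta> u v \<ge> 0" for u v
    using b by (auto simp: separation_dist_def split: enat.split)
  show "separation_dist T \<alpha> \<beta> x z \<le> separation_dist T \<alpha> \<beta> x y + separation_dist T \<alpha> \<beta> y z"
  proof (cases "separation_time T \<alpha> x z")
    case (enat n)
    let ?S = "{enat n | n. ?D x z n}"
    have ne: "?S \<noteq> {}"
      using enat unfolding separation_time_def by (auto simp: Inf_enat_def split: if_splits)
    then have "Inf ?S \<in> ?S"
      by (metis (mono_tags, lifting) Inf_enat_def LeastI ex_in_conv)
    then have "?D x z n" using enat unfolding separation_time_def by auto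
    moreover have "separation_dist T \<alpha> \<beta> x z = \<beta> ^ n" by (simp add: separation_dist_def enat)
    ultimately show ?thesis
      using D[of n] le[of n x y] le[of n y z] nonneg[of x y] nonneg[of y z] by linarith
  next
    case infinity
    then show ?thesis using nonneg[of x y] nonneg[of y z] by (simp add: separation_dist_def)
  qed
qed


section \<open>Groups\<close>

definition finitely_generated :: "('g, 'b) monoid_scheme \<Rightarrow> bool" where
  "finitely_generated G \<longleftrightarrow> (\<exists>S\<subseteq>carrier G. finite S \<and> generate G S = carrier G)"

text \<open>Amenability of a discrete group: there is a left-invariant finitely additive probability
  measure defined on all subsets.\<close>

definition amenable :: "('g, 'b) monoid_scheme \<Rightarrow> bool" where
  "amenable G \<longleftrightarrow> (\<exists>\<nu> :: 'g set \<Rightarrow> real.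
     (\<forall>A\<subseteq>carrier G. \<nu> A \<ge> 0) \<and> \<nu> (carrier G) = 1 \<and>
     (\<forall>A B. A \<subseteq> carrier G \<and> B \<subseteq> carrier G \<and> A \<inter> B = {} \<longrightarrow> \<nu> (A \<union> B) = \<nu> A + \<nu> B) \<and>
     (\<forall>g\<in>carrier G. \<forall>A\<subseteq>carrier G. \<nu> (g <#\<^bsub>G\<^esub> A) = \<nu> A))"

definition abelianization :: "('g, 'b) monoid_scheme \<Rightarrow> 'g set monoid" where
  "abelianization G = G Mod (derived G (carrier G))"

definition torsion_subgroup :: "('g, 'b) monoid_scheme \<Rightarrow> 'g set" where
  "torsion_subgroup G = {g \<in> carrier G. \<exists>n::nat. n > 0 \<and> g [^]\<^bsub>G\<^esub> n = \<one>\<^bsub>G\<^esub>}"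

definition free_abelianization :: "('g, 'b) monoid_scheme \<Rightarrow> 'g set set monoid" where
  "free_abelianization G = abelianization G Mod torsion_subgroup (abelianization G)"

definition free_ab_proj :: "('g, 'b) monoid_scheme \<Rightarrow> 'g \<Rightarrow> 'g set set" where
  "free_ab_proj G g =
    torsion_subgroup (abelianization G) #>\<^bsub>abelianization G\<^esub> (derived G (carrier G) #>\<^bsub>G\<^esub> g)"

text \<open>Densities with respect to counting measure on \<open>G\<close>, and their convolution.\<close>

definition group_convolution ::
  "('g, 'b) monoid_scheme \<Rightarrow> ('g \<Rightarrow> ennreal) \<Rightarrow> ('g \<Rightarrow> ennreal) \<Rightarrow> 'g \<Rightarrow> ennreal" where
  "group_convolution G \<nu> \<rho> g = (\<Sum>\<^sub>\<infinity>h\<in>carrier G. \<nu> h * \<rho> (inv\<^bsub>G\<^esub> h \<otimes>\<^bsub>G\<^esub> g))"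

primrec convolution_power ::
  "('g, 'b) monoid_scheme \<Rightarrow> ('g \<Rightarrow> ennreal) \<Rightarrow> nat \<Rightarrow> 'g \<Rightarrow> ennreal" where
  "convolution_power G \<nu> 0 = (\<lambda>g. if g = \<one>\<^bsub>G\<^esub> then 1 else 0)"
| "convolution_power G \<nu> (Suc k) = group_convolution G \<nu> (convolution_power G \<nu> k)"

definition spectral_radius :: "('g, 'b) monoid_scheme \<Rightarrow> ('g \<Rightarrow> ennreal) \<Rightarrow> ennreal" where
  "spectral_radius G \<nu> =
    limsup (\<lambda>k. ennreal (root k (enn2real (convolution_power G \<nu> k \<one>\<^bsub>G\<^esub>))))"


section \<open>Group extensions and pressure\<close>

definition group_extension ::
  "('g, 'b) monoid_scheme \<Rightarrow> ('x \<Rightarrow> 'x) \<Rightarrow> ('x \<Rightarrow> 'g) \<Rightarrow> 'x \<times> 'g \<Rightarrow> 'x \<times> 'g" where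
  "group_extension G T \<psi> = (\<lambda>(x, g). (T x, \<psi> x \<otimes>\<^bsub>G\<^esub> g))"

primrec cocycle ::
  "('g, 'b) monoid_scheme \<Rightarrow> ('x \<Rightarrow> 'x) \<Rightarrow> ('x \<Rightarrow> 'g) \<Rightarrow> nat \<Rightarrow> 'x \<Rightarrow> 'g" where
  "cocycle G T \<psi> 0 x = \<one>\<^bsub>G\<^esub>"
| "cocycle G T \<psi> (Suc n) x = \<psi> ((T ^^ n) x) \<otimes>\<^bsub>G\<^esub> cocycle G T \<psi> n x"

definition ennreal_log :: "ennreal \<Rightarrow> ereal" where
  "ennreal_log x = (if x = 0 then -\<infinity> else if x = \<infinity> then \<infinity> else ereal (ln (enn2real x)))"

text \<open>Exponential growth rate of the weighted sums over the sets \<open>E n\<close>.\<close>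

definition weighted_growth ::
  "('x \<Rightarrow> 'x) \<Rightarrow> ('x \<Rightarrow> real) \<Rightarrow> (nat \<Rightarrow> 'x set) \<Rightarrow> ereal" where
  "weighted_growth T \<phi> E =
    limsup (\<lambda>n. ennreal_log (\<Sum>\<^sub>\<infinity>x\<in>E n. ennreal (exp (birkhoff_sum T \<phi> n x))) / ereal (real n))"

definition base_pressure :: "('x \<Rightarrow> 'x) \<Rightarrow> ('x \<Rightarrow> real) \<Rightarrow> 'x set \<Rightarrow> ereal" where
  "base_pressure T \<phi> a = weighted_growth T \<phi> (\<lambda>n. {x \<in> a. (T ^^ n) x = x})"

definition extension_pressure ::
  "('g, 'b) monoid_scheme \<Rightarrow> ('x \<Rightarrow> 'x) \<Rightarrow> ('x \<Rightarrow> real) \<Rightarrow> ('x \<Rightarrow> 'g) \<Rightarrow> 'x set \<Rightarrow> 'g \<Rightarrow> ereal" where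
  "extension_pressure G T \<phi> \<psi> a g =
    weighted_growth T \<phi> (\<lambda>n. {x \<in> a. (T ^^ n) x = x \<and> cocycle G T \<psi> n x = g})"

definition ab_extension_pressure ::
  "('g, 'b) monoid_scheme \<Rightarrow> ('x \<Rightarrow> 'x) \<Rightarrow> ('x \<Rightarrow> real) \<Rightarrow> ('x \<Rightarrow> 'g) \<Rightarrow> 'x set \<Rightarrow> 'g set set \<Rightarrow> ereal"
  where
  "ab_extension_pressure G T \<phi> \<psi> a k =
    weighted_growth T \<phi> (\<lambda>n. {x \<in> a. (T ^^ n) x = x \<and> free_ab_proj G (cocycle G T \<psi> n x) = k})"

definition return_cylinders ::
  "'x measure \<Rightarrow> ('x \<Rightarrow> 'x) \<Rightarrow> 'x set set \<Rightarrow> 'x set \<Rightarrow> nat \<Rightarrow> 'x set set" where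
  "return_cylinders M T \<alpha> c n =
    {v \<in> cylinders (space M) T \<alpha> n.
      emeasure M (sym_diff (v \<inter> c) v) = 0 \<and> emeasure M (v \<inter> (T ^^ n) -` c) > 0}"

definition branch_weight :: "('x \<Rightarrow> 'x) \<Rightarrow> ('x \<Rightarrow> real) \<Rightarrow> 'x \<Rightarrow> nat \<Rightarrow> 'x set \<Rightarrow> ennreal" where
  "branch_weight T \<phi> \<xi> n v = ennreal (exp (birkhoff_sum T \<phi> n (the_inv_into v (T ^^ n) \<xi>)))"

text \<open>The measures \<open>m\<^sub>n\<close> on \<open>G\<close> associated with a cylinder \<open>c\<close> and a base point \<open>\<xi> \<in> c\<close>.\<close>

definition return_measure ::
  "'x measure \<Rightarrow> ('x \<Rightarrow> 'x) \<Rightarrow> 'x set set \<Rightarrow> ('x \<Rightarrow> real) \<Rightarrow> ('g, 'b) monoid_scheme \<Rightarrow> ('x \<Rightarrow> 'g) \<Rightarrow>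
    'x set \<Rightarrow> 'x \<Rightarrow> nat \<Rightarrow> 'g \<Rightarrow> ennreal" where
  "return_measure M T \<alpha> \<phi> G \<psi> c \<xi> n g =
    (\<Sum>\<^sub>\<infinity>v\<in>{v \<in> return_cylinders M T \<alpha> c n. \<forall>x\<in>v. cocycle G T \<psi> n x = g}. branch_weight T \<phi> \<xi> n v) /
    (\<Sum>\<^sub>\<infinity>v\<in>return_cylinders M T \<alpha> c n. branch_weight T \<phi> \<xi> n v)"

end

theory Submission
  imports Defs
begin

text \<open>
  Coding by words in the alphabet \<open>\<alpha>\<close>, bounded distortion makes the weight \<open>p w = \<mu>[w]\<close> multiplicative
  under concatenation up to a constant factor, and it is comparable to \<open>exp (\<phi>\<^sub>n x)\<close> for every \<open>x\<close>
  in \<open>[w]\<close>. All pressures are thus growth rates of sums of \<open>p w\<close> over words of length \<open>n\<close>; the base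
  pressure is \<open>0\<close>. By transitivity every group element is the value of a word, and prepending a
  fixed word shows that the growth rate \<open>P\<close> for the extension does not depend on \<open>a\<close> and \<open>g\<close>.

  For \<open>s > P\<close> the Green function \<open>H g = (\<Sum>w with value g. p w * exp (- s |w|))\<close> is finite, satisfies
  a Harnack inequality and is superharmonic up to a constant. Averaging the logarithmic increments
  of \<open>g \<mapsto> H (g\<^sup>-\<^sup>1)\<close> with an invariant mean gives a homomorphism \<open>\<eta> : G \<rightarrow> \<real>\<close>, and Jensen's
  inequality bounds the sum of \<open>p u * exp (\<eta> (u))\<close> over words \<open>u\<close> of length \<open>l\<close> by a constant times
  \<open>exp (s l)\<close>. As \<open>\<eta>\<close> vanishes on the kernel of the projection to the free abelianization, the
  abelianized pressure is at most \<open>s\<close>.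

  Quasi-multiplicativity also compares the convolution powers of \<open>m\<^sub>n\<close> with the sums over words of
  length \<open>n k\<close>, so the upper growth rate of \<open>\<lambda>(G, m\<^sub>n)\<close> is \<open>P\<close>, and a subsequence attains it.
\<close>

section \<open>Sums in the extended nonnegative reals and growth rates\<close>

lemma infsum_ennreal_SUP:
  fixes f :: "'a \<Rightarrow> ennreal"
  shows "infsum f A = (SUP F\<in>{F. finite F \<and> F \<subseteq> A}. sum f F)"
  by (rule nonneg_infsum_complete) simp

lemma infsum_ennreal_mono:
  fixes f g :: "'a \<Rightarrow> ennreal"
  assumes "\<And>x. x \<in> A \<Longrightarrow> f x \<le> g x"
  shows "infsum f A \<le> infsum g A"
  by (intro infsum_mono nonneg_summable_on_complete assms) auto

lemma sum_le_infsum_ennreal: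
  fixes f :: "'a \<Rightarrow> ennreal"
  assumes "finite F" "F \<subseteq> A"
  shows "sum f F \<le> infsum f A"
  unfolding infsum_ennreal_SUP using assms by (intro SUP_upper) auto

lemma infsum_ennreal_mono_set:
  fixes f :: "'a \<Rightarrow> ennreal"
  assumes "A \<subseteq> B"
  shows "infsum f A \<le> infsum f B"
  unfolding infsum_ennreal_SUP using assms by (intro SUP_subset_mono) auto

lemma infsum_ennreal_least:
  fixes f :: "'a \<Rightarrow> ennreal"
  assumes "\<And>F. finite F \<Longrightarrow> F \<subseteq> A \<Longrightarrow> sum f F \<le> c"
  shows "infsum f A \<le> c"
  unfolding infsum_ennreal_SUP using assms by (intro SUP_least) auto

lemma infsum_ennreal_cmult:
  fixes f :: "'a \<Rightarrow> ennreal"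
  shows "infsum (\<lambda>x. c * f x) A = c * infsum f A"
  unfolding infsum_ennreal_SUP SUP_mult_left_ennreal by (simp add: sum_distrib_left)

text \<open>Tonelli for unordered sums: a finite part of the Sigma set is covered by finitely many
  fibres, and the fibre sums over a finite \<open>F\<close> add up to the sum over
  \<open>Sigma F B\<close>.\<close>

lemma infsum_ennreal_Sigma:
  fixes f :: "'a \<Rightarrow> 'b \<Rightarrow> ennreal"
  shows "infsum (\<lambda>(x, y). f x y) (Sigma A B) = infsum (\<lambda>x. infsum (f x) (B x)) A"
proof (rule antisym)
  show "infsum (\<lambda>(x, y). f x y) (Sigma A B) \<le> infsum (\<lambda>x. infsum (f x) (B x)) A"
  proof (rule infsum_ennreal_least)
    fix F assume F: "finite F" "F \<subseteq> Sigma A B"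
    have eq: "Sigma (fst ` F) (\<lambda>x. {y. (x, y) \<in> F}) = F" by force
    have fin: "finite {y. (x, y) \<in> F}" for x
      by (rule finite_subset[of _ "snd ` F"]) (use F in force)+
    have "(\<Sum>(x, y)\<in>F. f x y) = (\<Sum>x\<in>fst ` F. \<Sum>y\<in>{y. (x, y) \<in> F}. f x y)"
      using F(1) fin by (subst sum.Sigma) (auto simp: eq)
    also have "\<dots> \<le> (\<Sum>x\<in>fst ` F. infsum (f x) (B x))"
      using F fin by (intro sum_mono sum_le_infsum_ennreal) auto
    also have "\<dots> \<le> infsum (\<lambda>x. infsum (f x) (B x)) A"
      using F by (intro sum_le_infsum_ennreal) auto
    finally show "(\<Sum>(x, y)\<in>F. f x y) \<le> infsum (\<lambda>x. infsum (f x) (B x)) A" .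
  qed
  show "infsum (\<lambda>x. infsum (f x) (B x)) A \<le> infsum (\<lambda>(x, y). f x y) (Sigma A B)"
  proof (rule infsum_ennreal_least)
    fix F assume F: "finite F" "F \<subseteq> A"
    have "(\<Sum>x\<in>F. infsum (f x) (B x)) = infsum (\<lambda>(x, y). f x y) (Sigma F B)"
      using F(1)
    proof (induction F)
      case (insert x F)
      have "Sigma (insert x F) B = Pair x ` B x \<union> Sigma F B" by auto
      then have "infsum (\<lambda>(x, y). f x y) (Sigma (insert x F) B) =
          infsum (\<lambda>(x, y). f x y) (Pair x ` B x) + infsum (\<lambda>(x, y). f x y) (Sigma F B)"
        using insert.hyps by (simp, subst infsum_Un_disjoint) (auto intro: nonneg_summable_on_complete)
      also have "infsum (\<lambda>(x, y). f x y) (Pair x ` B x) = infsum (f x) (B x)"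
        by (subst infsum_reindex) (auto simp: inj_on_def o_def)
      finally show ?case using insert by simp
    qed simp
    also have "\<dots> \<le> infsum (\<lambda>(x, y). f x y) (Sigma A B)"
      using F by (intro infsum_ennreal_mono_set) auto
    finally show "(\<Sum>x\<in>F. infsum (f x) (B x)) \<le> \<dots>" .
  qed
qed

text \<open>Main tool for comparing sums over words: \<open>h\<close> will be a concatenation map,
  an itinerary or a choice of periodic points, and only its injectivity has to be checked.\<close>

lemma infsum_ennreal_inj_le:
  fixes f :: "'a \<Rightarrow> ennreal" and g :: "'b \<Rightarrow> ennreal"
  assumes "inj_on h A" "\<And>x. x \<in> A \<Longrightarrow> h x \<in> B" "\<And>x. x \<in> A \<Longrightarrow> f x \<le> g (h x)"
  shows "infsum f A \<le> infsum g B"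
proof -
  have "infsum f A \<le> infsum (g \<circ> h) A"
    using assms by (intro infsum_ennreal_mono) auto
  also have "\<dots> = infsum g (h ` A)" using assms(1) by (simp add: infsum_reindex)
  also have "\<dots> \<le> infsum g B" using assms by (intro infsum_ennreal_mono_set) auto
  finally show ?thesis .
qed

lemma infsum_ennreal_fibres:
  fixes f :: "'a \<Rightarrow> ennreal"
  assumes "\<And>x. x \<in> A \<Longrightarrow> h x \<in> Y"
  shows "infsum f A = infsum (\<lambda>y. infsum f {x\<in>A. h x = y}) Y"
proof -
  have "infsum (\<lambda>y. infsum f {x\<in>A. h x = y}) Y =
      infsum (\<lambda>(y, x). f x) (SIGMA y:Y. {x\<in>A. h x = y})"
    by (rule infsum_ennreal_Sigma[symmetric])
  also have "(SIGMA y:Y. {x\<in>A. h x = y}) = (\<lambda>x. (h x, x)) ` A" using assms by auto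
  also have "infsum (\<lambda>(y, x). f x) \<dots> = infsum f A"
    by (subst infsum_reindex) (auto simp: inj_on_def o_def)
  finally show ?thesis by simp
qed

text \<open>Gives access to countable additivity of a measure when the measures of all cylinders of
  one length are summed.\<close>

lemma infsum_eq_nn_integral_count_space:
  fixes f :: "'a \<Rightarrow> ennreal"
  assumes "countable A"
  shows "infsum f A = (\<integral>\<^sup>+x. f x \<partial>count_space A)"
proof (cases "finite A")
  case True
  then show ?thesis by (simp add: nn_integral_count_space_finite)
next
  case False
  have bij: "bij_betw (from_nat_into A) UNIV A"
    using assms False by (rule bij_betw_from_nat_into)
  have "infsum f A = infsum (\<lambda>n. f (from_nat_into A n)) UNIV"
    by (rule infsum_reindex_bij_betw[OF bij, symmetric])
  also have "\<dots> = (\<Sum>n. f (from_nat_into A n))"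
    by (intro sums_unique has_sum_imp_sums has_sum_infsum nonneg_summable_on_complete) simp
  also have "\<dots> = (\<integral>\<^sup>+n. f (from_nat_into A n) \<partial>count_space UNIV)"
    by (rule nn_integral_count_space_nat[symmetric])
  also have "\<dots> = (\<integral>\<^sup>+x. f x \<partial>count_space A)"
    by (rule nn_integral_bij_count_space[OF bij])
  finally show ?thesis .
qed

section \<open>Exponential growth rates\<close>

definition growth :: "(nat \<Rightarrow> ennreal) \<Rightarrow> ereal" where
  "growth A = limsup (\<lambda>n. ennreal_log (A n) / ereal (real n))"

lemma growth_le:
  assumes "\<forall>\<^sub>F n in sequentially. A n \<le> ennreal (C * exp (s * real n))" "C > 0"
  shows "growth A \<le> ereal s"
proof -
  have "growth A \<le> limsup (\<lambda>n. ereal (ln C / real n + s))"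
    unfolding growth_def
  proof (rule Limsup_mono)
    show "\<forall>\<^sub>F n in sequentially. ennreal_log (A n) / ereal (real n) \<le> ereal (ln C / real n + s)"
      using assms(1) eventually_gt_at_top[of 0]
    proof eventually_elim
      case (elim n)
      show ?case
      proof (cases "A n" rule: ennreal_cases)
        case (real r)
        show ?thesis
        proof (cases "r = 0")
          case True
          with real elim show ?thesis by (simp add: ennreal_log_def)
        next
          case False
          with real have r: "r > 0" by simp
          have "r \<le> C * exp (s * real n)" using elim real assms(2) by simp
          then have "ln r \<le> ln (C * exp (s * real n))" using r assms(2) by simp
          also have "\<dots> = ln C + s * real n" using assms(2) by (simp add: ln_mult)
          finally show ?thesis using real r elim
            by (simp add: ennreal_log_def field_simps)
        qed
      next
        case top
        with elim show ?thesis by (simp add: top_unique)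
      qed
    qed
  qed
  also have "\<dots> = ereal s"
  proof (rule lim_imp_Limsup)
    have "(\<lambda>n. ln C / real n + s) \<longlonglongrightarrow> 0 + s"
      by (intro tendsto_add tendsto_const lim_const_over_n)
    then show "((\<lambda>n. ereal (ln C / real n + s)) \<longlongrightarrow> ereal s) sequentially" by simp
  qed simp
  finally show ?thesis .
qed

lemma growth_lessD:
  assumes "growth A < ereal s"
  shows "\<forall>\<^sub>F n in sequentially. A n \<le> ennreal (exp (s * real n))"
proof -
  have "\<forall>\<^sub>F n in sequentially. ennreal_log (A n) / ereal (real n) < ereal s"
    using assms unfolding growth_def by (rule Limsup_lessD)
  then show ?thesis
    using eventually_gt_at_top[of 0]
  proof eventually_elim
    case (elim n)
    show ?case
    proof (cases "A n" rule: ennreal_cases)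
      case (real r)
      show ?thesis
      proof (cases "r = 0")
        case False
        with real have r: "r > 0" by simp
        then have "ln r / real n < s" using elim real by (simp add: ennreal_log_def)
        then have "ln r < s * real n" using elim by (simp add: field_simps)
        then have "r < exp (s * real n)" using r by (metis exp_less_mono exp_ln)
        then show ?thesis using real by (simp add: ennreal_leI)
      qed (use real in simp)
    next
      case top
      with elim show ?thesis by (simp add: ennreal_log_def)
    qed
  qed
qed

text \<open>Real thresholds suffice because they are dense in the extended reals; this covers growth
  rate -\<infinity> without a case distinction.\<close>

lemma growth_le_growthI:
  assumes "\<And>s. growth B < ereal s \<Longrightarrow> growth A \<le> ereal s"
  shows "growth A \<le> growth B"
proof (rule ccontr)
  assume "\<not> growth A \<le> growth B"
  then obtain s where "growth B < ereal s" "ereal s < growth A"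
    by (meson not_le ereal_dense2)
  with assms[of s] show False by simp
qed

text \<open>A constant factor and an index shift by \<open>l\<close> change a bound
  \<open>exp (s * n)\<close> only by a constant, which disappears after taking logarithms and
  dividing by \<open>n\<close>.\<close>

lemma growth_le_shift:
  assumes "\<forall>\<^sub>F n in sequentially. A n \<le> C * B (n + l)" "C < \<infinity>"
  shows "growth A \<le> growth B"
proof (rule growth_le_growthI)
  fix s assume "growth B < ereal s"
  then have "\<forall>\<^sub>F n in sequentially. B (n + l) \<le> ennreal (exp (s * real (n + l)))"
    using growth_lessD[of B s] by (intro sequentially_offset[where P = "\<lambda>n. B n \<le> ennreal (exp (s * real n))"])
  with assms(1) have "\<forall>\<^sub>F n in sequentially.
      A n \<le> ennreal ((enn2real C + 1) * exp (s * real l) * exp (s * real n))"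
  proof eventually_elim
    case (elim n)
    \<comment> \<open>The summand 1 keeps the real constant positive even for \<open>C = 0\<close>,
      as \<open>growth_le\<close> requires.\<close>
    have C: "C \<le> ennreal (enn2real C + 1)"
      using assms(2) by (metis add.commute ennreal_enn2real_if enn2real_nonneg ennreal_leI infinity_ennreal_def le_add_same_cancel1 le_numeral_extra(1) less_irrefl add_increasing order_refl)
    have "A n \<le> C * B (n + l)" by (rule elim)
    also have "\<dots> \<le> ennreal (enn2real C + 1) * ennreal (exp (s * real (n + l)))"
      using elim C by (intro mult_mono) auto
    also have "\<dots> = ennreal ((enn2real C + 1) * exp (s * real l) * exp (s * real n))"
      by (simp add: ennreal_mult[symmetric] exp_add[symmetric] algebra_simps)
    finally show ?case .
  qed
  moreover have "(enn2real C + 1) * exp (s * real l) > 0"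
    by (simp add: add_nonneg_pos)
  ultimately show "growth A \<le> ereal s"
    by (rule growth_le)
qed

section \<open>Means of bounded functions\<close>

text \<open>Finite additivity is all that amenability provides, so the integral is built here by
  uniform approximation with functions of finitely many values.\<close>

locale fin_additive_prob =
  fixes X :: "'a set" and \<nu> :: "'a set \<Rightarrow> real"
  assumes nonneg: "A \<subseteq> X \<Longrightarrow> \<nu> A \<ge> 0"
    and total: "\<nu> X = 1"
    and additive: "A \<subseteq> X \<Longrightarrow> B \<subseteq> X \<Longrightarrow> A \<inter> B = {} \<Longrightarrow> \<nu> (A \<union> B) = \<nu> A + \<nu> B"
begin

lemma empty: "\<nu> {} = 0"
  using additive[of "{}" "{}"] by simp

lemma finite_additive:
  assumes "finite I" "\<And>i. i \<in> I \<Longrightarrow> A i \<subseteq> X" "disjoint_family_on A I"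
  shows "\<nu> (\<Union>i\<in>I. A i) = (\<Sum>i\<in>I. \<nu> (A i))"
  using assms
proof (induction I)
  case (insert i I)
  have "\<nu> (A i \<union> (\<Union>i\<in>I. A i)) = \<nu> (A i) + \<nu> (\<Union>i\<in>I. A i)"
    using insert.prems insert.hyps
    by (intro additive) (fastforce simp: disjoint_family_on_def)+
  also have "\<nu> (\<Union>i\<in>I. A i) = (\<Sum>i\<in>I. \<nu> (A i))"
    using insert.prems by (intro insert.IH) (auto simp: disjoint_family_on_def)
  finally show ?case using insert.hyps by simp
qed (simp add: empty)

text \<open>The integral of a function with finitely many values on \<open>X\<close>; for an
  infinite range the sum takes its default value 0.\<close>

definition simple_mean :: "('a \<Rightarrow> real) \<Rightarrow> real" where
  "simple_mean f = (\<Sum>y\<in>f ` X. y * \<nu> {x\<in>X. f x = y})"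

text \<open>The integral may be computed on the finer level sets of \<open>h\<close>. With
  \<open>h\<close> the pair of two functions, linearity and monotonicity become statements about one
  finite sum.\<close>

lemma simple_mean_factor:
  assumes fin: "finite (h ` X)"
  shows "simple_mean (\<lambda>x. F (h x)) = (\<Sum>c\<in>h ` X. F c * \<nu> {x\<in>X. h x = c})"
proof -
  have fin': "finite ((\<lambda>x. F (h x)) ` X)"
    using finite_imageI[OF fin, of F] by (simp add: image_image)
  have fib: "\<nu> {x\<in>X. F (h x) = y} = (\<Sum>c\<in>{c\<in>h ` X. F c = y}. \<nu> {x\<in>X. h x = c})" for y
  proof -
    have "{x\<in>X. F (h x) = y} = (\<Union>c\<in>{c\<in>h ` X. F c = y}. {x\<in>X. h x = c})" by auto
    then show ?thesis
      using fin by (simp only:) (intro finite_additive, auto simp: disjoint_family_on_def)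
  qed
  have "simple_mean (\<lambda>x. F (h x)) =
      (\<Sum>y\<in>(\<lambda>x. F (h x)) ` X. \<Sum>c\<in>{c\<in>h ` X. F c = y}. F c * \<nu> {x\<in>X. h x = c})"
    unfolding simple_mean_def fib by (simp add: sum_distrib_left)
  also have "\<dots> = (\<Sum>c\<in>h ` X. F c * \<nu> {x\<in>X. h x = c})"
    using fin fin' by (intro sum.group) auto
  finally show ?thesis .
qed

lemma simple_mean_comb:
  assumes "finite (f ` X)" "finite (g ` X)"
  shows "simple_mean (\<lambda>x. a * f x + b * g x) = a * simple_mean f + b * simple_mean g"
proof -
  let ?h = "\<lambda>x. (f x, g x)"
  have fin: "finite (?h ` X)"
    by (rule finite_subset[of _ "f ` X \<times> g ` X"]) (use assms in auto)
  show ?thesis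
    using simple_mean_factor[OF fin, of "\<lambda>(u, v). a * u + b * v"]
      simple_mean_factor[OF fin, of fst] simple_mean_factor[OF fin, of snd]
    by (simp add: case_prod_beta distrib_right sum.distrib sum_distrib_left mult.assoc)
qed

lemma simple_mean_mono:
  assumes "finite (f ` X)" "finite (g ` X)" "\<And>x. x \<in> X \<Longrightarrow> f x \<le> g x"
  shows "simple_mean f \<le> simple_mean g"
proof -
  let ?h = "\<lambda>x. (f x, g x)"
  have fin: "finite (?h ` X)"
    by (rule finite_subset[of _ "f ` X \<times> g ` X"]) (use assms in auto)
  have "(\<Sum>c\<in>?h ` X. fst c * \<nu> {x\<in>X. ?h x = c}) \<le> (\<Sum>c\<in>?h ` X. snd c * \<nu> {x\<in>X. ?h x = c})"
    using assms(3) by (intro sum_mono mult_right_mono nonneg) auto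
  then show ?thesis
    using simple_mean_factor[OF fin, of fst] simple_mean_factor[OF fin, of snd] by simp
qed

lemma simple_mean_const: "simple_mean (\<lambda>x. c) = c"
proof -
  have "X \<noteq> {}" using empty total by auto
  then have "(\<lambda>x. c) ` X = {c}" by auto
  then show ?thesis by (simp add: simple_mean_def total)
qed

text \<open>Lipschitz continuity in the uniform norm, which makes the integrals of successive
  approximations a Cauchy sequence.\<close>

lemma simple_mean_close:
  assumes "finite (f ` X)" "finite (g ` X)" "\<And>x. x \<in> X \<Longrightarrow> \<bar>f x - g x\<bar> \<le> e"
  shows "\<bar>simple_mean f - simple_mean g\<bar> \<le> e"
proof -
  have fin: "finite ((\<lambda>x. a * f x + b * g x) ` X)" for a b
    by (rule finite_subset[of _ "(\<lambda>(u, v). a * u + b * v) ` (f ` X \<times> g ` X)"]) (use assms in auto)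
  have c: "finite ((\<lambda>x. e) ` X)" by (rule finite_subset[of _ "{e}"]) auto
  have "simple_mean (\<lambda>x. 1 * f x + (-1) * g x) \<le> simple_mean (\<lambda>x. e)"
    by (rule simple_mean_mono[OF fin c]) (use assms(3) in fastforce)
  moreover have "simple_mean (\<lambda>x. (-1) * f x + 1 * g x) \<le> simple_mean (\<lambda>x. e)"
    by (rule simple_mean_mono[OF fin c]) (use assms(3) in fastforce)
  ultimately show ?thesis
    using simple_mean_comb[OF assms(1,2), of 1 "-1"] simple_mean_comb[OF assms(1,2), of "-1" 1]
    unfolding simple_mean_const by linarith
qed

section \<open>Extension of the mean to bounded functions by rounding\<close>

definition discretize :: "nat \<Rightarrow> ('a \<Rightarrow> real) \<Rightarrow> 'a \<Rightarrow> real" where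
  "discretize n f x = of_int \<lfloor>real (Suc n) * f x\<rfloor> / real (Suc n)"

lemma discretize_close: "\<bar>discretize n f x - f x\<bar> \<le> 1 / real (Suc n)"
proof -
  have "\<bar>of_int \<lfloor>real (Suc n) * f x\<rfloor> - real (Suc n) * f x\<bar> \<le> 1" by linarith
  then have "\<bar>of_int \<lfloor>real (Suc n) * f x\<rfloor> - real (Suc n) * f x\<bar> / real (Suc n) \<le> 1 / real (Suc n)"
    by (intro divide_right_mono) auto
  moreover have "discretize n f x - f x = (of_int \<lfloor>real (Suc n) * f x\<rfloor> - real (Suc n) * f x) / real (Suc n)"
    unfolding discretize_def by (simp add: diff_divide_distrib del: of_nat_Suc)
  ultimately show ?thesis by (simp add: abs_divide del: of_nat_Suc)
qed

definition bdd :: "('a \<Rightarrow> real) \<Rightarrow> bool" where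
  "bdd f \<longleftrightarrow> (\<exists>b. \<forall>x\<in>X. \<bar>f x\<bar> \<le> b)"

lemma bdd_comb: "bdd f \<Longrightarrow> bdd g \<Longrightarrow> bdd (\<lambda>x. a * f x + b * g x)"
proof -
  assume "bdd f" "bdd g"
  then obtain c d where cd: "\<forall>x\<in>X. \<bar>f x\<bar> \<le> c" "\<forall>x\<in>X. \<bar>g x\<bar> \<le> d" by (auto simp: bdd_def)
  have "\<bar>a * f x + b * g x\<bar> \<le> \<bar>a\<bar> * c + \<bar>b\<bar> * d" if "x \<in> X" for x
    by (rule order_trans[OF abs_triangle_ineq])
      (use cd that in \<open>auto simp: abs_mult intro!: add_mono mult_left_mono\<close>)
  then show ?thesis by (auto simp: bdd_def)
qed

lemma bdd_const: "bdd (\<lambda>x. c)"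
  by (auto simp: bdd_def)

lemma finite_discretize:
  assumes "bdd f"
  shows "finite (discretize n f ` X)"
proof -
  obtain b where b: "\<forall>x\<in>X. \<bar>f x\<bar> \<le> b" using assms by (auto simp: bdd_def)
  let ?N = "real (Suc n)"
  have "discretize n f ` X \<subseteq> (\<lambda>k. of_int k / ?N) ` {\<lfloor>- (?N * b)\<rfloor>..\<lfloor>?N * b\<rfloor>}"
  proof
    fix y assume "y \<in> discretize n f ` X"
    then obtain x where x: "x \<in> X" "y = discretize n f x" by auto
    have "- b \<le> f x" "f x \<le> b" using b x by force+
    then have "?N * (- b) \<le> ?N * f x" "?N * f x \<le> ?N * b"
      by (intro mult_left_mono; simp)+
    then have "\<lfloor>?N * f x\<rfloor> \<in> {\<lfloor>- (?N * b)\<rfloor>..\<lfloor>?N * b\<rfloor>}"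
      by (auto intro!: floor_mono)
    then show "y \<in> (\<lambda>k. of_int k / ?N) ` {\<lfloor>- (?N * b)\<rfloor>..\<lfloor>?N * b\<rfloor>}"
      using x(2) by (auto simp: discretize_def)
  qed
  then show ?thesis by (rule finite_subset) auto
qed

definition mean :: "('a \<Rightarrow> real) \<Rightarrow> real" where
  "mean f = lim (\<lambda>n. simple_mean (discretize n f))"

lemma mean_LIMSEQ:
  assumes "bdd f"
  shows "(\<lambda>n. simple_mean (discretize n f)) \<longlonglongrightarrow> mean f"
proof -
  have close: "\<bar>simple_mean (discretize n f) - simple_mean (discretize m f)\<bar>
      \<le> 1 / real (Suc n) + 1 / real (Suc m)" for n m
  proof (rule simple_mean_close)
    fix x
    show "\<bar>discretize n f x - discretize m f x\<bar> \<le> 1 / real (Suc n) + 1 / real (Suc m)"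
      using discretize_close[of n f x] discretize_close[of m f x] by linarith
  qed (use finite_discretize[OF assms] in auto)
  have "Cauchy (\<lambda>n. simple_mean (discretize n f))"
  proof (rule metric_CauchyI)
    fix e :: real assume "e > 0"
    then obtain N where N: "1 / real (Suc N) < e / 2"
      using nat_approx_posE[of "e / 2"] by auto
    have small: "1 / real (Suc n) < e / 2" if "n \<ge> N" for n
      by (rule le_less_trans[OF _ N]) (use that in \<open>auto simp: frac_le\<close>)
    show "\<exists>N. \<forall>m\<ge>N. \<forall>n\<ge>N. dist (simple_mean (discretize m f)) (simple_mean (discretize n f)) < e"
    proof (intro exI allI impI)
      fix m n assume "m \<ge> N" "n \<ge> N"
      then show "dist (simple_mean (discretize m f)) (simple_mean (discretize n f)) < e"
        using close[of m n] small[of m] small[of n] unfolding dist_real_def by linarith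
    qed
  qed
  then show ?thesis
    unfolding mean_def by (simp add: Cauchy_convergent_iff convergent_LIMSEQ_iff)
qed

lemma mean_close:
  assumes f: "bdd f" and s: "finite (s ` X)" and e: "\<And>x. x \<in> X \<Longrightarrow> \<bar>f x - s x\<bar> \<le> e"
  shows "\<bar>mean f - simple_mean s\<bar> \<le> e"
proof (rule LIMSEQ_le)
  show "(\<lambda>n. \<bar>simple_mean (discretize n f) - simple_mean s\<bar>) \<longlonglongrightarrow> \<bar>mean f - simple_mean s\<bar>"
    by (intro tendsto_intros mean_LIMSEQ f)
  have "(\<lambda>n. 1 / real (Suc n) + e) \<longlonglongrightarrow> 0 + e"
    by (intro tendsto_intros LIMSEQ_Suc[OF lim_1_over_n])
  then show "(\<lambda>n. 1 / real (Suc n) + e) \<longlonglongrightarrow> e" by simp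
  have "\<bar>simple_mean (discretize n f) - simple_mean s\<bar> \<le> 1 / real (Suc n) + e" for n
  proof (rule simple_mean_close)
    fix x assume "x \<in> X"
    then show "\<bar>discretize n f x - s x\<bar> \<le> 1 / real (Suc n) + e"
      using discretize_close[of n f x] e[of x] by linarith
  qed (use finite_discretize[OF f] s in auto)
  then show "\<exists>N. \<forall>n\<ge>N. \<bar>simple_mean (discretize n f) - simple_mean s\<bar> \<le> 1 / real (Suc n) + e"
    by blast
qed

text \<open>Rounding is not linear, so the combination of the rounded functions is compared with the
  combination itself through \<open>mean_close\<close>; the error tends to 0.\<close>

lemma mean_comb:
  assumes f: "bdd f" and g: "bdd g"
  shows "mean (\<lambda>x. a * f x + b * g x) = a * mean f + b * mean g"
proof -
  let ?h = "\<lambda>x. a * f x + b * g x"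
  let ?s = "\<lambda>n x. a * discretize n f x + b * discretize n g x"
  have fin: "finite (?s n ` X)" for n
    by (rule finite_subset[of _ "(\<lambda>(u, v). a * u + b * v) ` (discretize n f ` X \<times> discretize n g ` X)"])
      (use finite_discretize[OF f] finite_discretize[OF g] in auto)
  have "\<bar>mean ?h - simple_mean (?s n)\<bar> \<le> (\<bar>a\<bar> + \<bar>b\<bar>) * (1 / real (Suc n))" for n
  proof (rule mean_close[OF bdd_comb[OF f g] fin])
    fix x
    have "\<bar>?h x - ?s n x\<bar> = \<bar>a * (f x - discretize n f x) + b * (g x - discretize n g x)\<bar>"
      by (simp add: algebra_simps)
    also have "\<dots> \<le> \<bar>a\<bar> * \<bar>f x - discretize n f x\<bar> + \<bar>b\<bar> * \<bar>g x - discretize n g x\<bar>"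
      by (rule order_trans[OF abs_triangle_ineq]) (simp add: abs_mult)
    also have "\<dots> \<le> \<bar>a\<bar> * (1 / real (Suc n)) + \<bar>b\<bar> * (1 / real (Suc n))"
      using discretize_close[of n f x] discretize_close[of n g x]
      by (intro add_mono mult_left_mono) (auto simp: abs_minus_commute)
    also have "\<dots> = (\<bar>a\<bar> + \<bar>b\<bar>) * (1 / real (Suc n))"
      by (rule distrib_right[symmetric])
    finally show "\<bar>?h x - ?s n x\<bar> \<le> (\<bar>a\<bar> + \<bar>b\<bar>) * (1 / real (Suc n))" .
  qed
  note bound = this
  have "(\<lambda>n. (\<bar>a\<bar> + \<bar>b\<bar>) * (1 / real (Suc n))) \<longlonglongrightarrow> 0"
    by (rule tendsto_mult_right_zero[OF LIMSEQ_Suc[OF lim_1_over_n]])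
  then have "(\<lambda>n. mean ?h - simple_mean (?s n)) \<longlonglongrightarrow> 0"
    by (rule Lim_null_comparison[rotated]) (rule always_eventually, unfold real_norm_def, rule allI, rule bound)
  moreover have "(\<lambda>n. mean ?h - simple_mean (?s n)) \<longlonglongrightarrow> mean ?h - (a * mean f + b * mean g)"
  proof -
    have eq: "simple_mean (?s n) = a * simple_mean (discretize n f) + b * simple_mean (discretize n g)" for n
      by (rule simple_mean_comb[OF finite_discretize[OF f] finite_discretize[OF g]])
    show ?thesis
      unfolding eq by (intro tendsto_diff tendsto_add tendsto_mult tendsto_const mean_LIMSEQ f g)
  qed
  ultimately show ?thesis using LIMSEQ_unique by force
qed

lemma mean_const: "mean (\<lambda>x. c) = c"
proof -
  have "finite ((\<lambda>x. c) ` X)" by (rule finite_subset[of _ "{c}"]) auto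
  then show ?thesis
    using mean_close[of "\<lambda>x. c" "\<lambda>x. c" 0] by (simp add: bdd_const simple_mean_const)
qed

text \<open>Rounding goes downwards, hence every approximation already satisfies the bound.\<close>

lemma mean_le:
  assumes f: "bdd f" and c: "\<And>x. x \<in> X \<Longrightarrow> f x \<le> c"
  shows "mean f \<le> c"
proof (rule LIMSEQ_le_const2[OF mean_LIMSEQ[OF f]])
  have "simple_mean (discretize n f) \<le> c" for n
  proof -
    have "simple_mean (discretize n f) \<le> simple_mean (\<lambda>x. c)"
    proof (rule simple_mean_mono)
      fix x assume "x \<in> X"
      have "of_int \<lfloor>real (Suc n) * f x\<rfloor> \<le> real (Suc n) * f x" by linarith
      also have "\<dots> \<le> real (Suc n) * c" using c \<open>x \<in> X\<close> by (intro mult_left_mono) auto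
      finally show "discretize n f x \<le> c"
        unfolding discretize_def by (subst pos_divide_le_eq) (auto simp: mult.commute)
    qed (auto intro: finite_discretize f finite_subset[of _ "{c}"])
    then show ?thesis by (simp add: simple_mean_const)
  qed
  then show "\<exists>N. \<forall>n\<ge>N. simple_mean (discretize n f) \<le> c" by blast
qed

lemma bdd_sum:
  assumes "finite I" "\<And>i. i \<in> I \<Longrightarrow> bdd (f i)"
  shows "bdd (\<lambda>x. \<Sum>i\<in>I. f i x)"
  using assms
proof (induction I)
  case (insert i I)
  then have "bdd (\<lambda>x. 1 * f i x + 1 * (\<Sum>i\<in>I. f i x))" by (intro bdd_comb) auto
  with insert.hyps show ?case by simp
qed (simp add: bdd_const)

lemma mean_sum:
  assumes "finite I" "\<And>i. i \<in> I \<Longrightarrow> bdd (f i)"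
  shows "mean (\<lambda>x. \<Sum>i\<in>I. f i x) = (\<Sum>i\<in>I. mean (f i))"
  using assms
proof (induction I)
  case (insert i I)
  have "mean (\<lambda>x. 1 * f i x + 1 * (\<Sum>i\<in>I. f i x)) = 1 * mean (f i) + 1 * mean (\<lambda>x. \<Sum>i\<in>I. f i x)"
    using insert by (intro mean_comb bdd_sum) auto
  with insert show ?case by simp
qed (simp add: mean_const)

text \<open>The mean is computed from the values of \<open>f\<close> and the \<nu>-measures of level
  sets of its roundings, and composition with \<tau> changes neither.\<close>

lemma mean_invariant:
  assumes bij: "bij_betw \<tau> X X"
    and inv: "\<And>A. A \<subseteq> X \<Longrightarrow> \<nu> {x\<in>X. \<tau> x \<in> A} = \<nu> A"
  shows "mean (\<lambda>x. f (\<tau> x)) = mean f"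
proof -
  have "simple_mean (\<lambda>x. h (\<tau> x)) = simple_mean h" for h
  proof -
    have im: "(\<lambda>x. h (\<tau> x)) ` X = h ` X"
      using bij by (metis bij_betw_imp_surj_on image_image)
    have "\<nu> {x\<in>X. h (\<tau> x) = y} = \<nu> {x\<in>X. h x = y}" for y
    proof -
      have "{x\<in>X. h (\<tau> x) = y} = {x\<in>X. \<tau> x \<in> {x\<in>X. h x = y}}"
        using bij by (auto simp: bij_betw_def)
      then show ?thesis by (simp only:) (rule inv, auto)
    qed
    then show ?thesis by (simp add: simple_mean_def im)
  qed
  moreover have "discretize n (\<lambda>x. f (\<tau> x)) = (\<lambda>x. discretize n f (\<tau> x))" for n
    by (simp add: discretize_def fun_eq_iff)
  ultimately show ?thesis by (simp add: mean_def)
qed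

lemma mean_cong:
  assumes "bdd f" "\<And>x. x \<in> X \<Longrightarrow> f x = g x"
  shows "mean f = mean g"
proof -
  have g: "bdd g" using assms by (auto simp: bdd_def)
  have "mean (\<lambda>x. 1 * f x + (-1) * g x) \<le> 0" "mean (\<lambda>x. (-1) * f x + 1 * g x) \<le> 0"
    by (rule mean_le[OF bdd_comb[OF assms(1) g]]; simp add: assms(2))+
  then show ?thesis
    using mean_comb[OF assms(1) g, of 1 "-1"] mean_comb[OF assms(1) g, of "-1" 1] by simp
qed

end

section \<open>The free abelianization and invariant means\<close>

context group
begin

lemma torsion_subgroup_normal:
  assumes "comm_group G"
  shows "torsion_subgroup G \<lhd> G"
proof -
  interpret comm_group G by fact
  have "subgroup (torsion_subgroup G) G"
  proof (rule subgroupI)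
    show "torsion_subgroup G \<subseteq> carrier G" by (auto simp: torsion_subgroup_def)
    have "\<one> \<in> torsion_subgroup G"
      by (auto simp: torsion_subgroup_def intro!: exI[of _ 1])
    then show "torsion_subgroup G \<noteq> {}" by auto
  next
    fix a assume "a \<in> torsion_subgroup G"
    then show "inv a \<in> torsion_subgroup G"
      by (auto simp: torsion_subgroup_def nat_pow_inv)
  next
    fix a b assume "a \<in> torsion_subgroup G" "b \<in> torsion_subgroup G"
    then obtain m n :: nat where mn: "a \<in> carrier G" "b \<in> carrier G" "m > 0" "n > 0"
      "a [^] m = \<one>" "b [^] n = \<one>"
      by (auto simp: torsion_subgroup_def)
    have "(a \<otimes> b) [^] (m * n) = a [^] (m * n) \<otimes> b [^] (n * m)"
      using mn by (simp add: nat_pow_distrib mult.commute)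
    also have "\<dots> = \<one>" using mn by (simp add: nat_pow_pow[symmetric])
    finally show "a \<otimes> b \<in> torsion_subgroup G"
      using mn by (auto simp: torsion_subgroup_def intro!: exI[of _ "m * n"])
  qed
  then show ?thesis by (rule subgroup_imp_normal)
qed

lemma torsion_abelianization_normal:
  "torsion_subgroup (abelianization G) \<lhd> abelianization G"
proof -
  have "comm_group (abelianization G)"
    unfolding abelianization_def by (rule derived_quot_is_comm_group)
  then show ?thesis
    using group.torsion_subgroup_normal[OF comm_group.axioms(2)] by blast
qed

lemma free_ab_proj_hom: "free_ab_proj G \<in> hom G (free_abelianization G)"
proof -
  have "(\<lambda>A. torsion_subgroup (abelianization G) #>\<^bsub>abelianization G\<^esub> A) \<circ>
      (\<lambda>g. derived G (carrier G) #> g) \<in> hom G (free_abelianization G)"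
  proof (rule Group.hom_compose)
    show "(\<lambda>g. derived G (carrier G) #> g) \<in> hom G (abelianization G)"
      unfolding abelianization_def
      by (rule normal.r_coset_hom_Mod[OF derived_self_is_normal])
    show "(\<lambda>A. torsion_subgroup (abelianization G) #>\<^bsub>abelianization G\<^esub> A)
        \<in> hom (abelianization G) (free_abelianization G)"
      unfolding free_abelianization_def
      by (rule normal.r_coset_hom_Mod[OF torsion_abelianization_normal])
  qed
  then show ?thesis by (simp add: comp_def free_ab_proj_def[abs_def])
qed

lemma free_ab_proj_surj: "free_ab_proj G ` carrier G = carrier (free_abelianization G)"
  by (auto simp: free_ab_proj_def free_abelianization_def abelianization_def carrier_FactGroup)

lemma group_free_abelianization: "group (free_abelianization G)"
  unfolding free_abelianization_def
  by (rule normal.factorgroup_is_group[OF torsion_abelianization_normal])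

text \<open>An element is trivial in the free abelianization exactly when its class modulo the
  derived subgroup is torsion; the order of that class is the exponent \<open>n\<close>.\<close>

lemma free_ab_proj_kernel:
  assumes g: "g \<in> carrier G" and one: "free_ab_proj G g = \<one>\<^bsub>free_abelianization G\<^esub>"
  shows "\<exists>n::nat. n > 0 \<and> g [^] n \<in> derived G (carrier G)"
proof -
  let ?D = "derived G (carrier G)" and ?A = "abelianization G"
  interpret A: group ?A
    unfolding abelianization_def by (rule derived_quot_is_group)
  have hom: "(\<lambda>g. ?D #> g) \<in> hom G ?A"
    unfolding abelianization_def by (rule normal.r_coset_hom_Mod[OF derived_self_is_normal])
  interpret q: group_hom G ?A "\<lambda>g. ?D #> g"
    using hom by unfold_locales
  have sub: "subgroup (torsion_subgroup ?A) ?A"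
    using torsion_abelianization_normal by (rule normal_imp_subgroup)
  have "torsion_subgroup ?A #>\<^bsub>?A\<^esub> (?D #> g) = torsion_subgroup ?A"
    using one by (simp add: free_ab_proj_def free_abelianization_def)
  then have "?D #> g \<in> torsion_subgroup ?A"
    using A.rcos_self[OF _ sub, of "?D #> g"] g q.hom_closed by auto
  then obtain n :: nat where n: "n > 0" "(?D #> g) [^]\<^bsub>?A\<^esub> n = \<one>\<^bsub>?A\<^esub>"
    by (auto simp: torsion_subgroup_def)
  then have "?D #> (g [^] n) = ?D"
    using q.hom_nat_pow[OF g, of n] by (simp add: abelianization_def)
  moreover have "g [^] n \<in> ?D #> (g [^] n)"
    using g by (intro rcos_self derived_is_subgroup) auto
  ultimately show ?thesis using n by auto
qed

text \<open>A real character kills commutators, hence some positive power of \<open>g\<close>, and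
  the additive group of reals is torsion free. This is how the free abelianization enters the
  proof.\<close>

lemma character_vanishes_on_free_ab_kernel:
  fixes \<eta> :: "'a \<Rightarrow> real"
  assumes \<eta>: "\<And>x y. x \<in> carrier G \<Longrightarrow> y \<in> carrier G \<Longrightarrow> \<eta> (x \<otimes> y) = \<eta> x + \<eta> y"
    and g: "g \<in> carrier G" and one: "free_ab_proj G g = \<one>\<^bsub>free_abelianization G\<^esub>"
  shows "\<eta> g = 0"
proof -
  have \<eta>1: "\<eta> \<one> = 0" using \<eta>[of \<one> \<one>] by simp
  have \<eta>inv: "\<eta> (inv x) = - \<eta> x" if "x \<in> carrier G" for x
    using \<eta>[of x "inv x"] that \<eta>1 by simp
  have \<eta>pow: "\<eta> (x [^] n) = real n * \<eta> x" if "x \<in> carrier G" for x and n :: nat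
    by (induction n) (use that \<eta>1 \<eta> in \<open>auto simp: algebra_simps\<close>)
  let ?K = "{x\<in>carrier G. \<eta> x = 0}"
  have "subgroup ?K G"
    using \<eta>1 by (intro subgroupI) (auto simp: \<eta> \<eta>inv)
  moreover have "derived_set G (carrier G) \<subseteq> ?K"
    by (auto simp: \<eta> \<eta>inv)
  ultimately have "derived G (carrier G) \<subseteq> ?K"
    unfolding derived_def by (intro generate_subgroup_incl)
  moreover obtain n :: nat where "n > 0" "g [^] n \<in> derived G (carrier G)"
    using free_ab_proj_kernel[OF g one] by blast
  ultimately show ?thesis using \<eta>pow[OF g, of n] by auto
qed

lemma amenable_invariant_mean:
  assumes "amenable G"
  obtains \<nu> where "fin_additive_prob (carrier G) \<nu>"
    "\<And>f t. t \<in> carrier G \<Longrightarrow>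
      fin_additive_prob.mean (carrier G) \<nu> (\<lambda>g. f (t \<otimes> g)) = fin_additive_prob.mean (carrier G) \<nu> f"
proof -
  obtain \<nu> :: "'a set \<Rightarrow> real" where \<nu>:
    "(\<forall>A\<subseteq>carrier G. \<nu> A \<ge> 0) \<and> \<nu> (carrier G) = 1 \<and>
     (\<forall>A B. A \<subseteq> carrier G \<and> B \<subseteq> carrier G \<and> A \<inter> B = {} \<longrightarrow> \<nu> (A \<union> B) = \<nu> A + \<nu> B) \<and>
     (\<forall>g\<in>carrier G. \<forall>A\<subseteq>carrier G. \<nu> (g <# A) = \<nu> A)"
    using assms unfolding amenable_def by (rule exE)
  interpret fin_additive_prob "carrier G" \<nu>
    using \<nu> by unfold_locales auto
  have "mean (\<lambda>g. f (t \<otimes> g)) = mean f" if t: "t \<in> carrier G" for f t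
  proof (rule mean_invariant)
    show "bij_betw (\<lambda>g. t \<otimes> g) (carrier G) (carrier G)"
      by (rule bij_betwI[of _ _ _ "\<lambda>g. inv t \<otimes> g"]) (use t in \<open>auto simp: m_assoc[symmetric]\<close>)
    fix A assume A: "A \<subseteq> carrier G"
    \<comment> \<open>The preimage under left translation by \<open>t\<close> is the translate by
      \<open>inv t\<close>, to which invariance of \<nu> applies.\<close>
    have "{x \<in> carrier G. t \<otimes> x \<in> A} = inv t <# A"
    proof (intro equalityI subsetI)
      fix x assume x: "x \<in> {x \<in> carrier G. t \<otimes> x \<in> A}"
      then have "x = inv t \<otimes> (t \<otimes> x)" using t by (simp add: m_assoc[symmetric])
      then show "x \<in> inv t <# A" using x by (auto simp: l_coset_def)
    next
      fix x assume "x \<in> inv t <# A"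
      then obtain y where y: "y \<in> A" "x = inv t \<otimes> y" by (auto simp: l_coset_def)
      moreover have "y \<in> carrier G" using y A by auto
      ultimately show "x \<in> {x \<in> carrier G. t \<otimes> x \<in> A}"
        using t by (simp add: m_assoc[symmetric])
    qed
    then show "\<nu> {x \<in> carrier G. t \<otimes> x \<in> A} = \<nu> A" using \<nu> t A by simp
  qed
  with that fin_additive_prob_axioms show thesis by blast
qed

end

section \<open>Quasi-multiplicative weights on words\<close>

text \<open>Membership in \<open>lists A\<close> stays atomic for the classical reasoner instead of
  being expanded into a statement about all letters.\<close>

declare in_listsI [rule del] in_listsD [rule del]

text \<open>The order is reversed: the first letter is the rightmost factor, as in the cocycle,
  where later values multiply from the left.\<close>

primrec word_val :: "('g, 'b) monoid_scheme \<Rightarrow> ('a \<Rightarrow> 'g) \<Rightarrow> 'a list \<Rightarrow> 'g" where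
  "word_val G \<theta> [] = \<one>\<^bsub>G\<^esub>"
| "word_val G \<theta> (a # w) = word_val G \<theta> w \<otimes>\<^bsub>G\<^esub> \<theta> a"

definition words :: "'a set \<Rightarrow> nat \<Rightarrow> 'a list set" where
  "words A n = {w \<in> lists A. length w = n}"

lemma words_append: "u \<in> lists A \<Longrightarrow> w \<in> words A n \<Longrightarrow> u @ w \<in> words A (n + length u)"
  by (auto simp: words_def)

lemma words_lists: "w \<in> words A n \<Longrightarrow> w \<in> lists A"
  by (simp add: words_def)

text \<open>What the argument retains of the dynamics: \<open>K\<close> absorbs the distortion in
  both quasi-multiplicativity bounds, \<open>p_total\<close> reflects that cylinders of one length
  partition a probability space, and \<open>reach\<close> is what topological transitivity
  yields.\<close>

locale word_weights = group G for G (structure) +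
  fixes A :: "'a set" and p :: "'a list \<Rightarrow> ennreal" and K :: real and \<theta> :: "'a \<Rightarrow> 'g"
  assumes K_pos: "K > 0"
    and p_pos: "w \<in> lists A \<Longrightarrow> p w > 0"
    and p_super: "u \<in> lists A \<Longrightarrow> v \<in> lists A \<Longrightarrow> p u * p v \<le> ennreal K * p (u @ v)"
    and p_sub: "u \<in> lists A \<Longrightarrow> v \<in> lists A \<Longrightarrow> p (u @ v) \<le> ennreal K * (p u * p v)"
    and p_total: "infsum p (words A n) = 1"
    and \<theta>_closed: "a \<in> A \<Longrightarrow> \<theta> a \<in> carrier G"
    and reach: "g \<in> carrier G \<Longrightarrow> \<exists>w\<in>lists A. word_val G \<theta> w = g"
begin

abbreviation "val \<equiv> word_val G \<theta>"

lemma val_closed [simp]: "w \<in> lists A \<Longrightarrow> val w \<in> carrier G"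
  by (induction w) (auto simp: \<theta>_closed)

lemma val_append: "u \<in> lists A \<Longrightarrow> v \<in> lists A \<Longrightarrow> val (u @ v) = val v \<otimes> val u"
  by (induction u) (auto simp: \<theta>_closed m_assoc)

lemma p_le_1: "w \<in> lists A \<Longrightarrow> p w \<le> 1"
  using sum_le_infsum_ennreal[of "{w}" "words A (length w)" p] p_total[of "length w"]
  by (simp add: words_def)

lemma p_finite: "w \<in> lists A \<Longrightarrow> p w < \<infinity>"
  using p_le_1[of w] by (auto intro: le_less_trans)

lemma p_Nil: "p [] = 1"
proof -
  have "words A 0 = {[]}" by (auto simp: words_def)
  then show ?thesis using p_total[of 0] by simp
qed

lemma K_inverse_p_finite: "u \<in> lists A \<Longrightarrow> ennreal K * inverse (p u) < \<infinity>"
  using p_pos[of u] by (auto simp: ennreal_mult_eq_top_iff less_top[symmetric])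

text \<open>Obtained from \<open>p_super\<close> by dividing by \<open>p u\<close>: the cost of a
  prefix depends on the prefix alone.\<close>

lemma p_le_prepend:
  assumes "u \<in> lists A" "w \<in> lists A"
  shows "p w \<le> ennreal K * inverse (p u) * p (u @ w)"
proof -
  have "p w = inverse (p u) * (p u * p w)"
    using p_pos[OF assms(1)] p_finite[OF assms(1)]
    by (simp add: mult.assoc[symmetric] ennreal_divide_self[unfolded divide_ennreal_def] mult.commute[of "inverse _"] less_top)
  also have "\<dots> \<le> inverse (p u) * (ennreal K * p (u @ w))"
    using assms by (intro mult_left_mono p_super) auto
  finally show ?thesis by (simp add: mult_ac)
qed

text \<open>Prepending \<open>u\<close> injects the words of length \<open>n\<close> with
  \<open>Q\<close> into those of length \<open>n + length u\<close> with \<open>R\<close>, at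
  bounded cost. All independence statements for growth rates come from suitable choices of
  \<open>u\<close>.\<close>

lemma growth_prepend:
  assumes u: "u \<in> lists A"
    and QR: "\<And>w. w \<in> lists A \<Longrightarrow> Q w \<Longrightarrow> R (u @ w)"
  shows "growth (\<lambda>n. infsum p {w\<in>words A n. Q w}) \<le> growth (\<lambda>n. infsum p {w\<in>words A n. R w})"
proof (rule growth_le_shift)
  have "infsum p {w\<in>words A n. Q w} \<le>
      ennreal K * inverse (p u) * infsum p {w\<in>words A (n + length u). R w}" for n
    unfolding infsum_ennreal_cmult[symmetric]
    by (rule infsum_ennreal_inj_le[where h = "\<lambda>w. u @ w"])
      (use u in \<open>auto simp: inj_on_def words_append intro!: p_le_prepend QR intro: words_lists\<close>)
  then show "\<forall>\<^sub>F n in sequentially. infsum p {w\<in>words A n. Q w} \<le>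
      ennreal K * inverse (p u) * infsum p {w\<in>words A (n + length u). R w}"
    by simp
  show "ennreal K * inverse (p u) < \<infinity>" using u by (rule K_inverse_p_finite)
qed

section \<open>Sums over words with prescribed value\<close>

definition Z :: "nat \<Rightarrow> 'g \<Rightarrow> ennreal" where
  "Z n g = infsum p {w\<in>words A n. val w = g}"

definition pressure :: ereal where
  "pressure = growth (\<lambda>n. Z n \<one>)"

lemma growth_prefix_val:
  assumes c: "c \<in> lists A" and g: "g \<in> carrier G"
  shows "growth (\<lambda>n. infsum p {w\<in>words A n. take (length c) w = c \<and> val w = g}) = pressure"
proof (rule antisym)
  obtain u where u: "u \<in> lists A" "val u = inv g" using reach[of "inv g"] g by auto
  show "growth (\<lambda>n. infsum p {w\<in>words A n. take (length c) w = c \<and> val w = g}) \<le> pressure"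
    unfolding pressure_def Z_def
    by (rule growth_prepend[OF u(1)]) (use u g in \<open>auto simp: val_append\<close>)
  \<comment> \<open>Values multiply in reversed order, so prepending \<open>c @ v\<close> to a word
    of value \<one> produces \<open>val v \<otimes> val c\<close>, which equals
    \<open>g\<close>.\<close>
  obtain v where v: "v \<in> lists A" "val v = g \<otimes> inv (val c)"
    using reach[of "g \<otimes> inv (val c)"] c g by auto
  show "pressure \<le> growth (\<lambda>n. infsum p {w\<in>words A n. take (length c) w = c \<and> val w = g})"
    unfolding pressure_def Z_def
    by (rule growth_prepend[of "c @ v"])
      (use c v g in \<open>auto simp: val_append m_assoc\<close>)
qed

lemma growth_val: "g \<in> carrier G \<Longrightarrow> growth (\<lambda>n. Z n g) = pressure"
  using growth_prefix_val[of "[]" g] by (simp add: Z_def)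

text \<open>The total weight of each length is 1, and prepending \<open>c\<close> to all words shows
  that a fixed prefix does not lower the rate.\<close>

lemma growth_prefix:
  assumes c: "c \<in> lists A"
  shows "growth (\<lambda>n. infsum p {w\<in>words A n. take (length c) w = c}) = 0"
proof (rule antisym)
  have "infsum p {w\<in>words A n. take (length c) w = c} \<le> ennreal (1 * exp (0 * real n))" for n
    using infsum_ennreal_mono_set[of "{w\<in>words A n. take (length c) w = c}" "words A n" p]
    by (auto simp: p_total)
  then show "growth (\<lambda>n. infsum p {w\<in>words A n. take (length c) w = c}) \<le> 0"
    using growth_le[of "\<lambda>n. infsum p {w\<in>words A n. take (length c) w = c}" 1 0]
    by (simp add: zero_ereal_def)
  have "growth (\<lambda>n. infsum p {w\<in>words A n. True}) \<le>
      growth (\<lambda>n. infsum p {w\<in>words A n. take (length c) w = c})"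
    using c by (intro growth_prepend[of c]) auto
  moreover have "growth (\<lambda>n. infsum p {w\<in>words A n. True}) = limsup (\<lambda>n. 0)"
    by (simp add: growth_def p_total ennreal_log_def one_ennreal_def[symmetric] zero_ereal_def[symmetric])
  ultimately show "0 \<le> growth (\<lambda>n. infsum p {w\<in>words A n. take (length c) w = c})"
    by (simp add: Limsup_const)
qed

text \<open>Keeps the normalizing sums of the measures \<open>m_n\<close> away from 0, uniformly in
  \<open>n\<close>.\<close>

lemma prefix_total_ge:
  assumes c: "c \<in> lists A" and n: "length c \<le> n"
  shows "1 \<le> ennreal K * inverse (p c) * infsum p {w\<in>words A n. take (length c) w = c}"
proof -
  have "1 = infsum p (words A (n - length c))" by (simp add: p_total)
  also have "\<dots> \<le> ennreal K * inverse (p c) * infsum p {w\<in>words A n. take (length c) w = c}"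
    unfolding infsum_ennreal_cmult[symmetric]
    by (rule infsum_ennreal_inj_le[where h = "\<lambda>w. c @ w"])
      (use c n in \<open>auto simp: inj_on_def words_def intro: p_le_prepend\<close>)
  finally show ?thesis .
qed

section \<open>Convolution powers and spectral radii\<close>

lemma Z_le_1: "Z n g \<le> 1"
  unfolding Z_def p_total[of n, symmetric] by (intro infsum_ennreal_mono_set) auto

lemma Z_0: "Z 0 g = (if g = \<one> then 1 else 0)"
proof -
  have "{w \<in> words A 0. val w = g} = (if g = \<one> then {[]} else {})"
    by (auto simp: words_def)
  then show ?thesis by (simp add: Z_def p_Nil)
qed

text \<open>A pair of words with values \<open>h\<close> and \<open>inv h \<otimes> g\<close> is
  glued to \<open>v @ u\<close>, whose value is \<open>g\<close> because concatenation reverses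
  products. The lengths are fixed, so gluing is injective, and \<open>p_super\<close> costs one
  factor \<open>K\<close>.\<close>

lemma convolution_Z_le:
  assumes g: "g \<in> carrier G"
  shows "group_convolution G (Z n) (Z m) g \<le> ennreal K * Z (n + m) g"
proof -
  have "group_convolution G (Z n) (Z m) g =
      infsum (\<lambda>h. infsum (\<lambda>u. p u * Z m (inv (val u) \<otimes> g)) {u\<in>words A n. val u = h}) (carrier G)"
    unfolding group_convolution_def
  proof (rule infsum_cong)
    fix h
    have "infsum (\<lambda>u. p u * Z m (inv (val u) \<otimes> g)) {u\<in>words A n. val u = h} =
        infsum (\<lambda>u. Z m (inv h \<otimes> g) * p u) {u\<in>words A n. val u = h}"
      by (rule infsum_cong) (auto simp: mult.commute)
    then show "Z n h * Z m (inv h \<otimes> g) =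
        infsum (\<lambda>u. p u * Z m (inv (val u) \<otimes> g)) {u\<in>words A n. val u = h}"
      unfolding infsum_ennreal_cmult Z_def[of n] by (simp only: mult.commute)
  qed
  also have "\<dots> = infsum (\<lambda>u. p u * Z m (inv (val u) \<otimes> g)) (words A n)"
    by (rule infsum_ennreal_fibres[symmetric]) (intro val_closed words_lists)
  also have "\<dots> = infsum (\<lambda>u. infsum (\<lambda>v. p u * p v) {v\<in>words A m. val v = inv (val u) \<otimes> g}) (words A n)"
    by (simp add: infsum_ennreal_cmult Z_def)
  also have "\<dots> = infsum (\<lambda>(u, v). p u * p v) (SIGMA u:words A n. {v\<in>words A m. val v = inv (val u) \<otimes> g})"
    by (rule infsum_ennreal_Sigma[symmetric])
  also have "\<dots> \<le> infsum (\<lambda>w. ennreal K * p w) {w\<in>words A (n + m). val w = g}"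
  proof (rule infsum_ennreal_inj_le[where h = "\<lambda>(u, v). v @ u"])
    show "inj_on (\<lambda>(u, v). v @ u) (SIGMA u:words A n. {v\<in>words A m. val v = inv (val u) \<otimes> g})"
    proof (rule inj_onI)
      fix x y assume xy: "x \<in> (SIGMA u:words A n. {v\<in>words A m. val v = inv (val u) \<otimes> g})"
        "y \<in> (SIGMA u:words A n. {v\<in>words A m. val v = inv (val u) \<otimes> g})"
        "(case x of (u, v) \<Rightarrow> v @ u) = (case y of (u, v) \<Rightarrow> v @ u)"
      have "snd z \<in> words A m"
        if "z \<in> (SIGMA u:words A n. {v\<in>words A m. val v = inv (val u) \<otimes> g})" for z
        using that by (elim SigmaE CollectE conjE) (simp only: snd_conv)
      from this[OF xy(1)] this[OF xy(2)] have "length (snd x) = length (snd y)"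
        by (simp add: words_def)
      moreover have "snd x @ fst x = snd y @ fst y"
        using xy(3) by (simp add: case_prod_beta)
      ultimately show "x = y" by (simp add: prod_eq_iff)
    qed
  next
    fix x assume x: "x \<in> (SIGMA u:words A n. {v\<in>words A m. val v = inv (val u) \<otimes> g})"
    then obtain u v where uv: "x = (u, v)" "u \<in> words A n" "v \<in> words A m" "val v = inv (val u) \<otimes> g"
      by (elim SigmaE CollectE conjE)
    have l: "u \<in> lists A" "v \<in> lists A" using uv(2,3) by (auto intro: words_lists)
    have "val (v @ u) = g" using uv l g by (simp add: val_append m_assoc[symmetric])
    then show "(case x of (u, v) \<Rightarrow> v @ u) \<in> {w\<in>words A (n + m). val w = g}"
      using uv by (auto simp: words_def)
    show "(case x of (u, v) \<Rightarrow> p u * p v) \<le> ennreal K * p (case x of (u, v) \<Rightarrow> v @ u)"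
      using uv l p_super[of v u] by (simp add: mult.commute)
  qed
  finally show ?thesis by (simp add: infsum_ennreal_cmult Z_def)
qed

text \<open>Each convolution contributes one factor \<open>C\<close> from \<open>m\<close> and one
  factor \<open>K\<close> from gluing; the induction starts because \<open>Z 0\<close> is the point
  mass at \<one>.\<close>

lemma convolution_power_le:
  assumes m: "\<And>g. g \<in> carrier G \<Longrightarrow> m g \<le> ennreal C * Z n g" and C: "C \<ge> 0"
    and g: "g \<in> carrier G"
  shows "convolution_power G m k g \<le> ennreal ((C * K) ^ k) * Z (n * k) g"
  using g
proof (induction k arbitrary: g)
  case 0
  then show ?case by (simp add: Z_0)
next
  case (Suc k)
  have "convolution_power G m (Suc k) g \<le>
      infsum (\<lambda>h. (ennreal C * ennreal ((C * K) ^ k)) * (Z n h * Z (n * k) (inv h \<otimes> g))) (carrier G)"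
    unfolding convolution_power.simps group_convolution_def
  proof (rule infsum_ennreal_mono)
    fix h assume h: "h \<in> carrier G"
    have "m h * convolution_power G m k (inv h \<otimes> g) \<le>
        (ennreal C * Z n h) * (ennreal ((C * K) ^ k) * Z (n * k) (inv h \<otimes> g))"
      using h Suc.prems by (intro mult_mono m Suc.IH) auto
    then show "m h * convolution_power G m k (inv h \<otimes> g) \<le>
        (ennreal C * ennreal ((C * K) ^ k)) * (Z n h * Z (n * k) (inv h \<otimes> g))"
      by (simp add: mult_ac)
  qed
  also have "\<dots> = (ennreal C * ennreal ((C * K) ^ k)) * group_convolution G (Z n) (Z (n * k)) g"
    by (simp add: infsum_ennreal_cmult group_convolution_def)
  also have "\<dots> \<le> (ennreal C * ennreal ((C * K) ^ k)) * (ennreal K * Z (n + n * k) g)"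
    by (intro mult_left_mono convolution_Z_le Suc.prems) auto
  also have "\<dots> = (ennreal C * ennreal ((C * K) ^ k) * ennreal K) * Z (n * Suc k) g"
    by (simp add: mult_ac)
  also have "ennreal C * ennreal ((C * K) ^ k) * ennreal K = ennreal ((C * K) ^ Suc k)"
    using C K_pos by (simp add: ennreal_mult[symmetric] mult_ac)
  finally show ?case .
qed

text \<open>Only the path resting at \<one> is kept in every convolution.\<close>

lemma convolution_power_one_ge: "m \<one> ^ k \<le> convolution_power G m k \<one>"
proof (induction k)
  case (Suc k)
  have "m \<one> ^ Suc k \<le> m \<one> * convolution_power G m k (inv \<one> \<otimes> \<one>)"
    using Suc by (simp add: mult_left_mono)
  also have "\<dots> \<le> group_convolution G m (convolution_power G m k) \<one>"
    unfolding group_convolution_def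
    using sum_le_infsum_ennreal[of "{\<one>}" "carrier G" "\<lambda>h. m h * convolution_power G m k (inv h \<otimes> \<one>)"]
    by simp
  finally show ?case by simp
qed simp

lemma spectral_radius_ge:
  assumes m: "\<And>g. g \<in> carrier G \<Longrightarrow> m g \<le> ennreal C * Z n g" and C: "C \<ge> 0"
  shows "m \<one> \<le> spectral_radius G m"
proof -
  \<comment> \<open>Domination by \<open>Z\<close> makes the convolution powers finite, so
    \<open>enn2real\<close> does not send an infinite value to 0.\<close>
  have bound_finite: "x < \<infinity>" if "x \<le> ennreal c * Z n' \<one>" for x c n'
  proof -
    have "x \<le> ennreal c * 1"
      using that Z_le_1 by (rule order_trans[OF _ mult_left_mono]) simp
    then show ?thesis by (simp add: le_less_trans)
  qed
  have fin: "convolution_power G m k \<one> < \<infinity>" for k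
    using convolution_power_le[OF m C, of \<one> k] by (intro bound_finite) auto
  have m1: "m \<one> < \<infinity>"
    using m[of \<one>] by (intro bound_finite) auto
  have "m \<one> \<le> ennreal (root k (enn2real (convolution_power G m k \<one>)))" if "k > 0" for k
  proof -
    have "enn2real (m \<one>) = root k (enn2real (m \<one>) ^ k)"
      using that by (simp add: real_root_power_cancel)
    also have "enn2real (m \<one>) ^ k = enn2real (m \<one> ^ k)" 
      using m1 by (cases "m \<one>") (auto simp: ennreal_power)
    also have "root k \<dots> \<le> root k (enn2real (convolution_power G m k \<one>))"
      using that fin[of k] convolution_power_one_ge[of m k]
      by (intro real_root_le_mono enn2real_mono) auto
    finally have "ennreal (enn2real (m \<one>)) \<le> ennreal (root k (enn2real (convolution_power G m k \<one>)))"
      by (rule ennreal_leI)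
    then show ?thesis using m1 by (simp add: less_top)
  qed
  then have "\<forall>\<^sub>F k in sequentially. m \<one> \<le> ennreal (root k (enn2real (convolution_power G m k \<one>)))"
    by (intro eventually_mono[OF eventually_gt_at_top[of 0]])
  then have "limsup (\<lambda>k. m \<one>) \<le> spectral_radius G m"
    unfolding spectral_radius_def by (rule Limsup_mono)
  then show ?thesis by (simp add: Limsup_const)
qed

text \<open>Since \<open>n > 0\<close>, the lengths \<open>n * k\<close> tend to infinity and the
  growth bound for \<open>Z\<close> applies to them; the \<open>k\<close>-th root turns the factor
  \<open>(C * K) ^ k\<close> into a constant.\<close>

lemma spectral_radius_le:
  assumes m: "\<And>g. g \<in> carrier G \<Longrightarrow> m g \<le> ennreal C * Z n g" and C: "C \<ge> 0"
    and n: "n > 0" and s: "pressure < ereal s"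
  shows "spectral_radius G m \<le> ennreal (C * K * exp (s * real n))"
proof -
  have "filterlim (\<lambda>k. n * k) at_top sequentially"
    using n by (intro filterlim_at_top_mono[OF filterlim_ident]) auto
  then have "\<forall>\<^sub>F k in sequentially. Z (n * k) \<one> \<le> ennreal (exp (s * real (n * k)))"
    using growth_lessD[OF s[unfolded pressure_def]] filterlim_iff by blast
  then have "\<forall>\<^sub>F k in sequentially.
      ennreal (root k (enn2real (convolution_power G m k \<one>))) \<le> ennreal (C * K * exp (s * real n))"
    using eventually_gt_at_top[of 0]
  proof eventually_elim
    case (elim k)
    have nn: "0 \<le> C * K * exp (s * real n)" using C K_pos by simp
    have "convolution_power G m k \<one> \<le> ennreal ((C * K) ^ k) * Z (n * k) \<one>"
      by (rule convolution_power_le[OF m C]) auto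
    also have "\<dots> \<le> ennreal ((C * K) ^ k) * ennreal (exp (s * real (n * k)))"
      by (intro mult_left_mono elim) auto
    also have "\<dots> = ennreal ((C * K * exp (s * real n)) ^ k)"
      using C K_pos by (simp add: ennreal_mult[symmetric] power_mult_distrib exp_of_nat_mult[symmetric] mult_ac)
    finally have "enn2real (convolution_power G m k \<one>) \<le> (C * K * exp (s * real n)) ^ k"
      using nn by (intro enn2real_leI) auto
    then have "root k (enn2real (convolution_power G m k \<one>)) \<le> root k ((C * K * exp (s * real n)) ^ k)"
      using elim by (intro real_root_le_mono) auto
    also have "\<dots> = C * K * exp (s * real n)"
      using elim nn by (simp add: real_root_power_cancel)
    finally show ?case by (rule ennreal_leI)
  qed
  then have "spectral_radius G m \<le> limsup (\<lambda>k::nat. ennreal (C * K * exp (s * real n)))"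
    unfolding spectral_radius_def by (rule Limsup_mono)
  then show ?thesis by (simp add: Limsup_const)
qed

text \<open>The spectral radius of \<open>m n\<close> lies between \<open>m n \<one>\<close> and
  \<open>C * K * exp (s * n)\<close> for any \<open>s\<close> above the pressure, and constants do
  not affect growth in \<open>n\<close>.\<close>

lemma growth_spectral_radius:
  assumes c: "c \<in> lists A"
    and upper: "\<And>n g. n \<ge> n0 \<Longrightarrow> g \<in> carrier G \<Longrightarrow> m n g \<le> ennreal C * Z n g"
    and lower: "\<And>n. n \<ge> n0 \<Longrightarrow>
      infsum p {w\<in>words A n. take (length c) w = c \<and> val w = \<one>} \<le> ennreal D * m n \<one>"
    and C: "C > 0"
  shows "growth (\<lambda>n. spectral_radius G (m n)) = pressure"
proof (rule antisym)
  have "pressure = growth (\<lambda>n. infsum p {w\<in>words A n. take (length c) w = c \<and> val w = \<one>})"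
    using growth_prefix_val[OF c, of \<one>] by simp
  also have "\<dots> \<le> growth (\<lambda>n. spectral_radius G (m n))"
  proof (rule growth_le_shift[where l = 0 and C = "ennreal D"])
    show "\<forall>\<^sub>F n in sequentially. infsum p {w\<in>words A n. take (length c) w = c \<and> val w = \<one>}
        \<le> ennreal D * spectral_radius G (m (n + 0))"
      using eventually_ge_at_top[of n0]
    proof eventually_elim
      case (elim n)
      have "m n \<one> \<le> spectral_radius G (m n)"
        by (rule spectral_radius_ge[of "m n" C n]) (use upper elim C in auto)
      then show ?case
        using lower[OF elim] by (simp add: order_trans[OF _ mult_left_mono])
    qed
  qed simp
  finally show "pressure \<le> growth (\<lambda>n. spectral_radius G (m n))" .
  show "growth (\<lambda>n. spectral_radius G (m n)) \<le> pressure"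
    unfolding pressure_def
  proof (rule growth_le_growthI)
    fix s assume s: "growth (\<lambda>n. Z n \<one>) < ereal s"
    show "growth (\<lambda>n. spectral_radius G (m n)) \<le> ereal s"
    proof (rule growth_le)
      show "\<forall>\<^sub>F n in sequentially. spectral_radius G (m n) \<le> ennreal (C * K * exp (s * real n))"
        using eventually_ge_at_top[of "max 1 n0"]
      proof eventually_elim
        case (elim n)
        show ?case
          by (rule spectral_radius_le) (use elim upper C s in \<open>auto simp: pressure_def\<close>)
      qed
      show "C * K > 0" using C K_pos by simp
    qed
  qed
qed

end

section \<open>The Green function and amenability\<close>

lemma infsum_ennreal_less_top_of_summable:
  fixes f :: "nat \<Rightarrow> ennreal"
  assumes "summable b" "\<And>n. b n \<ge> 0" "\<And>n. f n \<le> ennreal (b n)"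
  shows "infsum f UNIV < \<infinity>"
proof -
  have "infsum f UNIV \<le> infsum (\<lambda>n. ennreal (b n)) UNIV"
    by (intro infsum_ennreal_mono assms)
  also have "\<dots> = (\<Sum>n. ennreal (b n))"
    by (intro sums_unique has_sum_imp_sums has_sum_infsum nonneg_summable_on_complete) simp
  also have "\<dots> = ennreal (\<Sum>n. b n)"
    using assms by (intro suminf_ennreal2) auto
  finally show ?thesis by (simp add: le_less_trans)
qed

context word_weights
begin

text \<open>Superharmonicity of the Green function bounds a weighted sum of exponentials of
  increments of its logarithm. After averaging over \<open>G\<close> the increments become a
  character, which vanishes on the words considered, so only their weights remain.\<close>

lemma amenable_kernel_bound:
  assumes am: "amenable G" and s: "pressure < ereal s"
  shows "infsum p {w\<in>words A l. free_ab_proj G (val w) = \<one>\<^bsub>free_abelianization G\<^esub>}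
    \<le> ennreal (K * exp (s * real l))"
proof -
  \<comment> \<open>Weights tilted by \<open>exp (- s * |w|)\<close>: the real version serves
    logarithms and means, the extended version \<open>q\<close> serves unordered sums.\<close>
  define qr where "qr w = enn2real (p w) * exp (- s * real (length w))" for w
  define q where "q w = ennreal (qr w)" for w
  have p_real: "p w = ennreal (enn2real (p w))" if "w \<in> lists A" for w
    using p_finite[OF that] by (simp add: less_top)
  have qr_pos: "qr w > 0" if "w \<in> lists A" for w
    using p_pos[OF that] p_finite[OF that] by (simp add: qr_def enn2real_positive_iff)
  have q_eq: "q w = p w * ennreal (exp (- s * real (length w)))" if "w \<in> lists A" for w
    using p_real[OF that] by (simp add: q_def qr_def ennreal_mult)
  have q_super: "q u * q v \<le> ennreal K * q (u @ v)" if "u \<in> lists A" "v \<in> lists A" for u v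
  proof -
    have uv: "u @ v \<in> lists A" using that by auto
    have "q u * q v = (p u * p v) * ennreal (exp (- s * real (length (u @ v))))"
    proof -
      have "ennreal (exp (- s * real (length (u @ v)))) =
          ennreal (exp (- s * real (length u))) * ennreal (exp (- s * real (length v)))"
        by (simp add: ennreal_mult[symmetric] exp_add[symmetric] algebra_simps)
      then show ?thesis using that by (simp add: q_eq mult_ac)
    qed
    also have "\<dots> \<le> (ennreal K * p (u @ v)) * ennreal (exp (- s * real (length (u @ v))))"
      using that by (intro mult_right_mono p_super) auto
    finally show ?thesis by (simp add: q_eq[OF uv] mult_ac)
  qed

  define H where "H g = infsum q {w\<in>lists A. val w = g}" for g
  have H_finite: "H g < \<infinity>" if g: "g \<in> carrier G" for g
  proof -
    \<comment> \<open>A rate strictly between the pressure and \<open>s\<close> leaves the geometric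
      ratio \<open>exp (s' - s) < 1\<close>.\<close>
    obtain s' where s': "pressure < ereal s'" "s' < s"
      using ereal_dense2[OF s] by auto
    have "growth (\<lambda>n. Z n g) < ereal s'" using growth_val[OF g] s' by simp
    from growth_lessD[OF this] obtain N where N: "\<And>n. n \<ge> N \<Longrightarrow> Z n g \<le> ennreal (exp (s' * real n))"
      by (auto simp: eventually_at_top_linorder)
    have "H g = infsum (\<lambda>n. infsum q {w\<in>{w\<in>lists A. val w = g}. length w = n}) UNIV"
      unfolding H_def by (rule infsum_ennreal_fibres) simp
    also have "\<dots> = infsum (\<lambda>n. ennreal (exp (- s * real n)) * Z n g) UNIV"
    proof (rule infsum_cong)
      fix n
      have "infsum q {w\<in>{w\<in>lists A. val w = g}. length w = n} =
          infsum (\<lambda>w. ennreal (exp (- s * real n)) * p w) {w\<in>words A n. val w = g}"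
        by (rule infsum_cong_neutral) (auto simp: words_def q_eq mult.commute)
      then show "infsum q {w\<in>{w\<in>lists A. val w = g}. length w = n} = ennreal (exp (- s * real n)) * Z n g"
        by (simp add: infsum_ennreal_cmult Z_def)
    qed
    also have "\<dots> < \<infinity>"
    proof (rule infsum_ennreal_less_top_of_summable)
      \<comment> \<open>Beyond \<open>N\<close> the series is dominated geometrically; the finitely
        many earlier terms are controlled by \<open>Z n g \<le> 1\<close>.\<close>
      let ?b = "\<lambda>n. if n < N then exp (- s * real n) else exp (s' - s) ^ n"
      have "summable (\<lambda>n. exp (s' - s) ^ n)"
        using s' by (intro summable_geometric) auto
      moreover have "\<forall>\<^sub>F n in sequentially. ?b n = exp (s' - s) ^ n"
        using eventually_ge_at_top[of N] by eventually_elim auto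
      ultimately show "summable ?b" by (subst summable_cong)
      show "?b n \<ge> 0" for n by simp
      show "ennreal (exp (- s * real n)) * Z n g \<le> ennreal (?b n)" for n
      proof (cases "n < N")
        case True
        have "ennreal (exp (- s * real n)) * Z n g \<le> ennreal (exp (- s * real n)) * 1"
          by (intro mult_left_mono Z_le_1) auto
        then show ?thesis using True by simp
      next
        case False
        have "ennreal (exp (- s * real n)) * Z n g \<le> ennreal (exp (- s * real n)) * ennreal (exp (s' * real n))"
          using False by (intro mult_left_mono N) auto
        also have "\<dots> = ennreal (exp (s' - s) ^ n)"
          by (simp add: ennreal_mult[symmetric] exp_add[symmetric] exp_of_nat_mult[symmetric] algebra_simps)
        finally show ?thesis using False by simp
      qed
    qed
    finally show ?thesis .
  qed
  have H_ge: "q w \<le> H (val w)" if "w \<in> lists A" for w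
    using sum_le_infsum_ennreal[of "{w}" "{w'\<in>lists A. val w' = val w}" q] that by (simp add: H_def)
  define h where "h g = enn2real (H g)" for g
  have H_h: "H g = ennreal (h g)" if "g \<in> carrier G" for g
    using H_finite[OF that] by (simp add: h_def less_top)
  have h_pos: "h g > 0" if g: "g \<in> carrier G" for g
  proof -
    obtain w where w: "w \<in> lists A" "val w = g" using reach[OF g] by auto
    have "0 < q w" using qr_pos[OF w(1)] by (simp add: q_def)
    also have "q w \<le> H g" using H_ge[OF w(1)] w(2) by simp
    finally show ?thesis using H_finite[OF g] by (simp add: h_def enn2real_positive_iff)
  qed
  \<comment> \<open>Reading off the first \<open>u\<close> of a word makes \<open>H\<close> superharmonic up to the factor \<open>K\<close>.\<close>
  have superharmonic: "(\<Sum>u\<in>U. qr u * h (g \<otimes> inv (val u))) \<le> K * h g"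
    if U: "finite U" "U \<subseteq> words A n" and g: "g \<in> carrier G" for U n g
  proof -
    let ?V = "\<lambda>u. {v\<in>lists A. val v = g \<otimes> inv (val u)}"
    have Ul: "u \<in> lists A" if "u \<in> U" for u using U that by (auto simp: words_def)
    have "(\<Sum>u\<in>U. q u * H (g \<otimes> inv (val u))) = infsum (\<lambda>u. infsum (\<lambda>v. q u * q v) (?V u)) U"
      using U(1) by (simp add: infsum_ennreal_cmult H_def)
    also have "\<dots> = infsum (\<lambda>(u, v). q u * q v) (Sigma U ?V)"
      by (rule infsum_ennreal_Sigma[symmetric])
    also have "\<dots> \<le> infsum (\<lambda>w. ennreal K * q w) {w\<in>lists A. val w = g}"
    proof (rule infsum_ennreal_inj_le[where h = "\<lambda>(u, v). u @ v"])
      show "inj_on (\<lambda>(u, v). u @ v) (Sigma U ?V)"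
      proof (rule inj_onI)
        fix x y assume xy: "x \<in> Sigma U ?V" "y \<in> Sigma U ?V"
          "(case x of (u, v) \<Rightarrow> u @ v) = (case y of (u, v) \<Rightarrow> u @ v)"
        have "fst z \<in> U" if "z \<in> Sigma U ?V" for z
          using that by (elim SigmaE) (simp only: fst_conv)
        from this[OF xy(1)] this[OF xy(2)] have "length (fst x) = length (fst y)"
          using U(2) by (auto simp: words_def)
        moreover have "fst x @ snd x = fst y @ snd y"
          using xy(3) by (simp add: case_prod_beta)
        ultimately show "x = y" by (simp add: prod_eq_iff)
      qed
      fix x assume "x \<in> Sigma U ?V"
      then obtain u v where uv: "x = (u, v)" "u \<in> U" "v \<in> lists A" "val v = g \<otimes> inv (val u)"
        by (elim SigmaE CollectE conjE)
      have u: "u \<in> lists A" by (rule Ul[OF uv(2)])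
      have "val (u @ v) = g" using u uv(3,4) g by (simp add: val_append m_assoc)
      then show "(case x of (u, v) \<Rightarrow> u @ v) \<in> {w\<in>lists A. val w = g}"
        using u uv(1,3) by auto
      show "(case x of (u, v) \<Rightarrow> q u * q v) \<le> ennreal K * q (case x of (u, v) \<Rightarrow> u @ v)"
        using u uv(1,3) q_super by simp
    qed
    also have "\<dots> = ennreal K * H g" by (simp add: infsum_ennreal_cmult H_def)
    also have "(\<Sum>u\<in>U. q u * H (g \<otimes> inv (val u))) = ennreal (\<Sum>u\<in>U. qr u * h (g \<otimes> inv (val u)))"
    proof -
      have "q u * H (g \<otimes> inv (val u)) = ennreal (qr u * h (g \<otimes> inv (val u)))" if "u \<in> U" for u
        using Ul[OF that] g qr_pos[of u] h_pos[of "g \<otimes> inv (val u)"]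
        by (simp add: q_def H_h ennreal_mult)
      moreover have "0 \<le> qr u * h (g \<otimes> inv (val u))" if "u \<in> U" for u
        using Ul[OF that] g qr_pos[of u] h_pos[of "g \<otimes> inv (val u)"] by simp
      ultimately show ?thesis by (simp add: sum_ennreal)
    qed
    also have "ennreal K * H g = ennreal (K * h g)"
      using K_pos h_pos[OF g] by (simp add: H_h[OF g] ennreal_mult)
    finally show ?thesis using K_pos h_pos[OF g] by (simp add: ennreal_le_iff)
  qed

  \<comment> \<open>Superharmonicity translates the argument of \<open>h\<close> on the right; the
    inverse turns this into left translation, under which the mean is invariant.\<close>
  define F where "F g = ln (h (inv g))" for g
  have F_increment: "\<exists>c. \<forall>g\<in>carrier G. F g - F (t \<otimes> g) \<le> c" if t: "t \<in> carrier G" for t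
  proof -
    \<comment> \<open>Retaining a single word of value \<open>inv t\<close> in the superharmonic
      inequality gives a Harnack inequality with constant \<open>K / qr u\<close>.\<close>
    obtain u where u: "u \<in> lists A" "val u = inv t" using reach[of "inv t"] t by auto
    have "F g - F (t \<otimes> g) \<le> ln (K / qr u)" if g: "g \<in> carrier G" for g
    proof -
      have "qr u * h (inv (t \<otimes> g) \<otimes> inv (val u)) \<le> K * h (inv (t \<otimes> g))"
        using superharmonic[of "{u}" "length u" "inv (t \<otimes> g)"] u t g by (simp add: words_def)
      also have "inv (t \<otimes> g) \<otimes> inv (val u) = inv g"
        using u t g by (simp add: inv_mult_group m_assoc)
      finally have "h (inv g) \<le> K / qr u * h (inv (t \<otimes> g))"
        using qr_pos[OF u(1)] by (simp add: field_simps)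
      then have "ln (h (inv g)) \<le> ln (K / qr u * h (inv (t \<otimes> g)))"
        using h_pos[of "inv g"] g by (subst ln_le_cancel_iff) auto
      also have "\<dots> = ln (K / qr u) + ln (h (inv (t \<otimes> g)))"
        using h_pos[of "inv (t \<otimes> g)"] K_pos qr_pos[OF u(1)] t g by (subst ln_mult) auto
      finally show ?thesis by (simp add: F_def)
    qed
    then show ?thesis by blast
  qed

  obtain \<nu> where \<nu>: "fin_additive_prob (carrier G) \<nu>"
    and inv_mean: "\<And>f t. t \<in> carrier G \<Longrightarrow>
      fin_additive_prob.mean (carrier G) \<nu> (\<lambda>g. f (t \<otimes> g)) = fin_additive_prob.mean (carrier G) \<nu> f"
    using amenable_invariant_mean[OF am] by metis
  interpret mean: fin_additive_prob "carrier G" \<nu> by fact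
  have F_bdd: "mean.bdd (\<lambda>g. F (t \<otimes> g) - F g)" if t: "t \<in> carrier G" for t
  proof -
    obtain c where c: "\<And>g. g \<in> carrier G \<Longrightarrow> F g - F (t \<otimes> g) \<le> c"
      using F_increment[OF t] by auto
    obtain c' where c': "\<And>g. g \<in> carrier G \<Longrightarrow> F g - F (inv t \<otimes> g) \<le> c'"
      using F_increment[of "inv t"] t by auto
    \<comment> \<open>The reverse inequality is the one-sided bound for \<open>inv t\<close> at the
      point \<open>t \<otimes> g\<close>.\<close>
    have "\<bar>F (t \<otimes> g) - F g\<bar> \<le> max c c'" if g: "g \<in> carrier G" for g
      using c[OF g] c'[of "t \<otimes> g"] t g by (simp add: m_assoc[symmetric])
    then show ?thesis by (auto simp: mean.bdd_def)
  qed
  \<comment> \<open>Only increments of \<open>F\<close> are known to be bounded, so the mean is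
    applied to them and not to \<open>F\<close>.\<close>
  define \<eta> where "\<eta> t = mean.mean (\<lambda>g. F (t \<otimes> g) - F g)" for t
  have \<eta>_hom: "\<eta> (x \<otimes> y) = \<eta> x + \<eta> y" if x: "x \<in> carrier G" and y: "y \<in> carrier G" for x y
  proof -
    have b: "mean.bdd (\<lambda>g. F (x \<otimes> (y \<otimes> g)) - F (y \<otimes> g))"
      using F_bdd[OF x] y by (auto simp: mean.bdd_def)
    \<comment> \<open>The increment along \<open>x \<otimes> y\<close> telescopes through
      \<open>y \<otimes> g\<close>; invariance then removes the translation by \<open>y\<close> from
      the first part.\<close>
    have "\<eta> (x \<otimes> y) = mean.mean (\<lambda>g. 1 * (F (x \<otimes> (y \<otimes> g)) - F (y \<otimes> g)) + 1 * (F (y \<otimes> g) - F g))"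
      unfolding \<eta>_def using x y by (intro mean.mean_cong F_bdd) (auto simp: m_assoc)
    also have "\<dots> = 1 * mean.mean (\<lambda>g. F (x \<otimes> (y \<otimes> g)) - F (y \<otimes> g)) + 1 * \<eta> y"
      unfolding \<eta>_def by (rule mean.mean_comb[OF b F_bdd[OF y]])
    also have "mean.mean (\<lambda>g. F (x \<otimes> (y \<otimes> g)) - F (y \<otimes> g)) = \<eta> x"
      unfolding \<eta>_def by (rule inv_mean[OF y, of "\<lambda>g. F (x \<otimes> g) - F g"])
    finally show ?thesis by simp
  qed

  show ?thesis
  proof (rule infsum_ennreal_least)
    fix U assume U: "finite U"
      "U \<subseteq> {w\<in>words A l. free_ab_proj G (val w) = \<one>\<^bsub>free_abelianization G\<^esub>}"
    have Ul: "u \<in> lists A" "length u = l" if "u \<in> U" for u using U that by (auto simp: words_def)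
    let ?d = "\<lambda>u g. F (val u \<otimes> g) - F g"
    have \<eta>0: "\<eta> (val u) = 0" if "u \<in> U" for u
      by (rule character_vanishes_on_free_ab_kernel[OF \<eta>_hom]) (use that U Ul in auto)
    \<comment> \<open>Pointwise in \<open>g\<close>, the inequality \<open>1 + d \<le> exp d\<close>
      replaces ratios of Green functions by increments of \<open>F\<close>. This linear form is
      enough because the increments will average to 0.\<close>
    have ub: "(\<Sum>u\<in>U. qr u * 1 + qr u * ?d u g) \<le> K" if g: "g \<in> carrier G" for g
    proof -
      have "(\<Sum>u\<in>U. qr u * 1 + qr u * ?d u g) \<le> (\<Sum>u\<in>U. qr u * h (inv g \<otimes> inv (val u)) / h (inv g))"
      proof (rule sum_mono)
        fix u assume u: "u \<in> U"
        have "1 + ?d u g \<le> exp (?d u g)" by (rule exp_ge_add_one_self)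
        also have "\<dots> = h (inv (val u \<otimes> g)) / h (inv g)"
          using h_pos[of "inv g"] h_pos[of "inv (val u \<otimes> g)"] Ul[OF u] g by (simp add: F_def exp_diff)
        also have "inv (val u \<otimes> g) = inv g \<otimes> inv (val u)"
          using Ul[OF u] g by (simp add: inv_mult_group)
        finally have "qr u * (1 + ?d u g) \<le> qr u * (h (inv g \<otimes> inv (val u)) / h (inv g))"
          using qr_pos[of u] Ul[OF u] by (intro mult_left_mono) auto
        then show "qr u * 1 + qr u * ?d u g \<le> qr u * h (inv g \<otimes> inv (val u)) / h (inv g)"
          by (simp add: distrib_left)
      qed
      also have "\<dots> = (\<Sum>u\<in>U. qr u * h (inv g \<otimes> inv (val u))) / h (inv g)"
        by (rule sum_divide_distrib[symmetric])
      also have "\<dots> \<le> K"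
        using superharmonic[of U l "inv g"] U g h_pos[of "inv g"]
        by (subst pos_divide_le_eq) auto
      finally show ?thesis .
    qed
    have bd: "mean.bdd (?d u)" if "u \<in> U" for u using F_bdd Ul[OF that] by simp
    have b: "mean.bdd (\<lambda>g. qr u * 1 + qr u * ?d u g)" if "u \<in> U" for u
      by (rule mean.bdd_comb[OF mean.bdd_const bd[OF that]])
    \<comment> \<open>The mean of the increment at \<open>u\<close> is
      \<open>\<eta> (val u) = 0\<close>, so every summand averages to \<open>qr u\<close>.\<close>
    have "(\<Sum>u\<in>U. qr u) = (\<Sum>u\<in>U. mean.mean (\<lambda>g. qr u * 1 + qr u * ?d u g))"
    proof (rule sum.cong[OF refl])
      fix u assume u: "u \<in> U"
      have "mean.mean (\<lambda>g. qr u * 1 + qr u * ?d u g) = qr u * mean.mean (\<lambda>g. 1) + qr u * mean.mean (?d u)"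
        by (rule mean.mean_comb[OF mean.bdd_const bd[OF u]])
      then show "qr u = mean.mean (\<lambda>g. qr u * 1 + qr u * ?d u g)"
        using \<eta>0[OF u] by (simp add: \<eta>_def mean.mean_const)
    qed
    also have "\<dots> = mean.mean (\<lambda>g. \<Sum>u\<in>U. qr u * 1 + qr u * ?d u g)"
      using U(1) b by (rule mean.mean_sum[symmetric])
    also have "\<dots> \<le> K"
      using U(1) b ub by (intro mean.mean_le mean.bdd_sum)
    \<comment> \<open>All words in \<open>U\<close> have length \<open>l\<close>, so one common
      factor undoes the tilt.\<close>
    finally have "(\<Sum>u\<in>U. qr u) * exp (s * real l) \<le> K * exp (s * real l)" by simp
    moreover have "(\<Sum>u\<in>U. qr u) * exp (s * real l) = (\<Sum>u\<in>U. enn2real (p u))"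
      unfolding sum_distrib_right qr_def
      by (rule sum.cong) (auto simp: Ul mult.assoc exp_add[symmetric])
    ultimately have "ennreal (\<Sum>u\<in>U. enn2real (p u)) \<le> ennreal (K * exp (s * real l))"
      by (simp add: ennreal_leI)
    then show "sum p U \<le> ennreal (K * exp (s * real l))"
      using p_real Ul by (simp add: sum_ennreal[symmetric] del: sum_ennreal)
  qed
qed

text \<open>From below, restrict to a single element \<open>g\<close> over \<open>k\<close>. From
  above, a prefix of value \<open>inv g\<close> moves all values into the kernel of the projection,
  where \<open>amenable_kernel_bound\<close> holds for every \<open>s\<close> above the
  pressure.\<close>

lemma growth_prefix_free_ab:
  assumes am: "amenable G" and c: "c \<in> lists A" and k: "k \<in> carrier (free_abelianization G)"
  shows "growth (\<lambda>n. infsum p {w\<in>words A n. take (length c) w = c \<and> free_ab_proj G (val w) = k}) = pressure"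
proof (rule antisym)
  interpret Q: group_hom G "free_abelianization G" "free_ab_proj G"
    using free_ab_proj_hom group_free_abelianization is_group
    by (simp add: group_hom_def group_hom_axioms_def)
  obtain g where g: "g \<in> carrier G" "free_ab_proj G g = k"
    using k by (auto simp: free_ab_proj_surj[symmetric])
  have "pressure = growth (\<lambda>n. infsum p {w\<in>words A n. take (length c) w = c \<and> val w = g})"
    using growth_prefix_val[OF c g(1)] by simp
  also have "\<dots> \<le> growth (\<lambda>n. infsum p {w\<in>words A n. take (length c) w = c \<and> free_ab_proj G (val w) = k})"
    using g by (intro growth_prepend[of "[]"]) auto
  finally show "pressure \<le> \<dots>" .
  obtain u where u: "u \<in> lists A" "val u = inv g" using reach[of "inv g"] g by auto
  have "growth (\<lambda>n. infsum p {w\<in>words A n. take (length c) w = c \<and> free_ab_proj G (val w) = k}) \<le>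
      growth (\<lambda>n. infsum p {w\<in>words A n. free_ab_proj G (val w) = \<one>\<^bsub>free_abelianization G\<^esub>})"
    by (rule growth_prepend[OF u(1)]) (use u g in \<open>auto simp: val_append\<close>)
  also have "\<dots> \<le> pressure"
    unfolding pressure_def
  proof (rule growth_le_growthI)
    fix s assume s: "growth (\<lambda>n. Z n \<one>) < ereal s"
    show "growth (\<lambda>n. infsum p {w\<in>words A n. free_ab_proj G (val w) = \<one>\<^bsub>free_abelianization G\<^esub>}) \<le> ereal s"
      using amenable_kernel_bound[OF am, folded pressure_def] s K_pos
      by (intro growth_le[of _ K]) (auto simp: pressure_def)
  qed
  finally show "growth (\<lambda>n. infsum p {w\<in>words A n. take (length c) w = c \<and> free_ab_proj G (val w) = k}) \<le> pressure" .
qed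

end

section \<open>Cylinders and periodic points\<close>

lemma birkhoff_sum_Suc: "birkhoff_sum T \<phi> (Suc n) x = \<phi> x + birkhoff_sum T \<phi> n (T x)"
  unfolding birkhoff_sum_def by (subst sum.lessThan_Suc_shift) (simp add: funpow_swap1)

text \<open>The inverse branch along a word: the first letter is applied last, since the orbit of
  the resulting point visits it first.\<close>

primrec branch_inv :: "('x \<Rightarrow> 'x) \<Rightarrow> 'x set list \<Rightarrow> 'x \<Rightarrow> 'x" where
  "branch_inv T [] x = x"
| "branch_inv T (a # w) x = the_inv_into a T (branch_inv T w x)"

lemma branch_inv_append: "branch_inv T (u @ v) x = branch_inv T u (branch_inv T v x)"
  by (induction u) auto

text \<open>Full branches make every finite word admissible; completeness of the separation metrics
  turns nested cylinders of growing length into actual points.\<close>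

locale full_gibbs_markov = gibbs_markov M T \<alpha> \<phi> TX
  for M :: "'x measure" and T \<alpha> \<phi> TX +
  assumes full: "full_branches M T \<alpha>"
    and complete: "\<And>\<beta>. 0 < \<beta> \<Longrightarrow> \<beta> < 1 \<Longrightarrow>
      Metric_space.mcomplete (space M) (separation_dist T \<alpha> \<beta>)"
begin

abbreviation "X \<equiv> space M"
abbreviation "binv \<equiv> branch_inv T"

definition cyl :: "'x set list \<Rightarrow> 'x set" where
  "cyl w = {x \<in> X. \<forall>j<length w. (T ^^ j) x \<in> w ! j}"

text \<open>Logarithm of the Jacobian of the inverse branch along \<open>w\<close>, see
  \<open>nn_integral_cyl\<close>.\<close>

definition S :: "'x set list \<Rightarrow> 'x \<Rightarrow> real" where
  "S w x = birkhoff_sum T \<phi> (length w) (binv w x)"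

lemma element_subset: "a \<in> \<alpha> \<Longrightarrow> x \<in> a \<Longrightarrow> x \<in> X"
  using partition(1) by (auto simp: partition_on_def)

lemma T_closed: "x \<in> X \<Longrightarrow> T x \<in> X"
  using T_measurable by (rule measurable_space)

lemma funpow_closed: "x \<in> X \<Longrightarrow> (T ^^ n) x \<in> X"
  by (induction n) (auto simp: T_closed)

lemma element_unique: "a \<in> \<alpha> \<Longrightarrow> b \<in> \<alpha> \<Longrightarrow> x \<in> a \<Longrightarrow> x \<in> b \<Longrightarrow> a = b"
  using partition(1) by (auto simp: partition_on_def disjoint_def)

lemma element_exists: "x \<in> X \<Longrightarrow> \<exists>a\<in>\<alpha>. x \<in> a"
  using partition(1) by (auto simp: partition_on_def)

lemma inj_on_element: "a \<in> \<alpha> \<Longrightarrow> inj_on T a"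
  using T_bij by (auto simp: bij_betw_def)

lemma image_element: "a \<in> \<alpha> \<Longrightarrow> T ` a = X"
  using full by (simp add: full_branches_def)

lemma the_inv_into_in: "a \<in> \<alpha> \<Longrightarrow> x \<in> X \<Longrightarrow> the_inv_into a T x \<in> a"
  using the_inv_into_into[OF inj_on_element, of a x a] image_element by auto

lemma T_the_inv_into: "a \<in> \<alpha> \<Longrightarrow> x \<in> X \<Longrightarrow> T (the_inv_into a T x) = x"
  using f_the_inv_into_f[OF inj_on_element, of a x] image_element by auto

lemma binv_closed: "w \<in> lists \<alpha> \<Longrightarrow> x \<in> X \<Longrightarrow> binv w x \<in> X"
  by (induction w) (auto intro: element_subset the_inv_into_in)

lemma cyl_Nil: "cyl [] = X"
  by (simp add: cyl_def)

lemma cyl_Cons: "a \<in> \<alpha> \<Longrightarrow> cyl (a # w) = {x \<in> a. T x \<in> cyl w}"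
  by (auto simp: cyl_def less_Suc_eq_0_disj element_subset T_closed funpow_swap1)

lemma cyl_append: "u \<in> lists \<alpha> \<Longrightarrow> cyl (u @ v) = {x \<in> cyl u. (T ^^ length u) x \<in> cyl v}"
proof (induction u)
  case Nil
  then show ?case by (auto simp: cyl_def)
next
  case (Cons a u)
  then show ?case by (auto simp: cyl_Cons funpow_swap1)
qed

lemma cyl_subset: "x \<in> cyl w \<Longrightarrow> x \<in> X"
  by (simp add: cyl_def)

lemma binv_in_cyl: "w \<in> lists \<alpha> \<Longrightarrow> x \<in> X \<Longrightarrow> binv w x \<in> cyl w"
  by (induction w) (auto simp: cyl_Nil cyl_Cons the_inv_into_in T_the_inv_into binv_closed)

lemma funpow_binv: "w \<in> lists \<alpha> \<Longrightarrow> x \<in> X \<Longrightarrow> (T ^^ length w) (binv w x) = x"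
proof (induction w)
  case (Cons a w)
  then show ?case
    by (auto simp: funpow_Suc_right T_the_inv_into binv_closed simp del: funpow.simps)
qed simp

lemma binv_funpow: "w \<in> lists \<alpha> \<Longrightarrow> x \<in> cyl w \<Longrightarrow> binv w ((T ^^ length w) x) = x"
proof (induction w arbitrary: x)
  case (Cons a w)
  then show ?case
    by (auto simp: funpow_Suc_right cyl_Cons the_inv_into_f_f inj_on_element simp del: funpow.simps)
qed simp

lemma inj_on_cyl: "w \<in> lists \<alpha> \<Longrightarrow> inj_on (T ^^ length w) (cyl w)"
  by (rule inj_on_inverseI[of _ "binv w"]) (rule binv_funpow)

lemma the_inv_into_cyl:
  assumes "w \<in> lists \<alpha>" "x \<in> X"
  shows "the_inv_into (cyl w) (T ^^ length w) x = binv w x"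
  using the_inv_into_f_f[OF inj_on_cyl[OF assms(1)] binv_in_cyl[OF assms]] assms
  by (simp add: funpow_binv)

lemma S_append:
  assumes "u \<in> lists \<alpha>" "v \<in> lists \<alpha>" "x \<in> X"
  shows "S (u @ v) x = S u (binv v x) + S v x"
  using assms(1)
proof (induction u)
  case Nil
  then show ?case by (simp add: S_def birkhoff_sum_def)
next
  case (Cons a u)
  then show ?case using assms(2,3)
    by (auto simp: S_def birkhoff_sum_Suc branch_inv_append T_the_inv_into binv_closed)
qed

lemma S_Cons: "a \<in> \<alpha> \<Longrightarrow> w \<in> lists \<alpha> \<Longrightarrow> x \<in> X \<Longrightarrow> S (a # w) x = \<phi> (binv (a # w) x) + S w x"
  by (simp add: S_def birkhoff_sum_Suc T_the_inv_into binv_closed)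

lemma word_unique:
  assumes "u \<in> words \<alpha> n" "v \<in> words \<alpha> n" "x \<in> cyl u" "x \<in> cyl v"
  shows "u = v"
proof (rule nth_equalityI)
  show "length u = length v" using assms by (simp add: words_def)
  fix i assume "i < length u"
  moreover have "set u \<subseteq> \<alpha>" "set v \<subseteq> \<alpha>" using assms by (auto simp: words_def in_lists_conv_set)
  ultimately show "u ! i = v ! i"
    using assms by (intro element_unique[of _ _ "(T ^^ i) x"]) (auto simp: cyl_def words_def)
qed

lemma word_exists: "x \<in> X \<Longrightarrow> \<exists>w\<in>words \<alpha> n. x \<in> cyl w"
proof (induction n arbitrary: x)
  case 0
  then show ?case by (auto simp: words_def cyl_Nil)
next
  case (Suc n)
  obtain w where w: "w \<in> words \<alpha> n" "T x \<in> cyl w" using Suc T_closed by blast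
  obtain a where "a \<in> \<alpha>" "x \<in> a" using element_exists Suc by blast
  with w show ?case by (intro bexI[of _ "a # w"]) (auto simp: cyl_Cons words_def)
qed

text \<open>Every word has a nonempty cylinder, because \<open>binv w x\<close> lies in it for any
  \<open>x\<close>.\<close>

lemma cylinders_eq: "cylinders X T \<alpha> n = cyl ` words \<alpha> n"
proof (intro equalityI subsetI)
  fix v assume "v \<in> cylinders X T \<alpha> n"
  then obtain c where c: "\<forall>j<n. c j \<in> \<alpha>" "v = {x \<in> X. \<forall>j<n. (T ^^ j) x \<in> c j}"
    by (auto simp: cylinders_def)
  then have "v = cyl (map c [0..<n])" by (auto simp: cyl_def)
  moreover have "map c [0..<n] \<in> words \<alpha> n" using c by (auto simp: words_def in_lists_conv_set)
  ultimately show "v \<in> cyl ` words \<alpha> n" by auto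
next
  fix v assume "v \<in> cyl ` words \<alpha> n"
  then obtain w where w: "w \<in> words \<alpha> n" "v = cyl w" by auto
  obtain x where "x \<in> X" using not_empty by auto
  then have "v \<noteq> {}" using binv_in_cyl[of w x] w by (auto simp: words_def)
  moreover have "w ! j \<in> \<alpha>" if "j < n" for j
    using w(1) that by (auto simp: words_def in_lists_conv_set)
  ultimately show "v \<in> cylinders X T \<alpha> n"
    using w by (auto simp: cylinders_def cyl_def words_def intro!: exI[of _ "(!) w"])
qed

section \<open>The separation metric, bounded distortion and periodic points\<close>

lemma separation_time_ge:
  assumes "\<And>j. j < n \<Longrightarrow> \<exists>a\<in>\<alpha>. (T ^^ j) x \<in> a \<and> (T ^^ j) y \<in> a"
  shows "separation_time T \<alpha> x y \<ge> enat n"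
  unfolding separation_time_def
proof (rule Inf_greatest)
  fix e assume "e \<in> {enat n |n. \<not> (\<exists>a\<in>\<alpha>. (T ^^ n) x \<in> a \<and> (T ^^ n) y \<in> a)}"
  then obtain m where "e = enat m" "\<not> (\<exists>a\<in>\<alpha>. (T ^^ m) x \<in> a \<and> (T ^^ m) y \<in> a)" by auto
  then show "enat n \<le> e" using assms[of m] by (cases "m < n") auto
qed

lemma separation_time_le:
  assumes "\<not> (\<exists>a\<in>\<alpha>. (T ^^ n) x \<in> a \<and> (T ^^ n) y \<in> a)"
  shows "separation_time T \<alpha> x y \<le> enat n"
  unfolding separation_time_def using assms by (intro Inf_lower) auto

lemma separation_time_cyl:
  assumes "w \<in> lists \<alpha>" "x \<in> cyl w" "y \<in> cyl w"
  shows "separation_time T \<alpha> x y \<ge> enat (length w)"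
  using assms by (intro separation_time_ge) (auto simp: cyl_def in_lists_conv_set intro!: bexI[of _ "w ! _"])

lemma separation_dist_cyl:
  assumes "0 < \<beta>" "\<beta> < 1" "w \<in> lists \<alpha>" "x \<in> cyl w" "y \<in> cyl w"
  shows "separation_dist T \<alpha> \<beta> x y \<le> \<beta> ^ length w"
  using separation_time_cyl[OF assms(3-5)] assms(1,2)
  by (auto simp: separation_dist_def power_decreasing split: enat.split)

text \<open>The strict inequality gives agreement up to and including index \<open>n\<close>:
  separation at some \<open>j \<le> n\<close> would force distance at least
  \<open>\<beta> ^ n\<close>.\<close>

lemma separation_dist_less_imp:
  assumes "0 < \<beta>" "\<beta> < 1" "separation_dist T \<alpha> \<beta> x y < \<beta> ^ n" "j \<le> n"
  shows "\<exists>a\<in>\<alpha>. (T ^^ j) x \<in> a \<and> (T ^^ j) y \<in> a"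
proof (rule ccontr)
  assume "\<not> ?thesis"
  then have "separation_time T \<alpha> x y \<le> enat j" by (rule separation_time_le)
  then obtain k where k: "separation_time T \<alpha> x y = enat k" "k \<le> j"
    by (cases "separation_time T \<alpha> x y") auto
  then have "\<beta> ^ n \<le> separation_dist T \<alpha> \<beta> x y"
    using assms by (auto simp: separation_dist_def power_decreasing)
  with assms show False by simp
qed

text \<open>Two preimages along a word share the cylinder of every remaining suffix, so the
  Lipschitz condition bounds the differences of \<phi> by \<open>C * \<beta> ^ j\<close> with
  \<open>j\<close> the suffix length. The geometric series gives
  \<open>D = C / (1 - \<beta>)\<close>.\<close>

lemma bounded_distortion:
  obtains D where "\<And>w x y. w \<in> lists \<alpha> \<Longrightarrow> x \<in> X \<Longrightarrow> y \<in> X \<Longrightarrow> S w x \<le> S w y + D"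
proof -
  obtain C \<beta> where C: "C > 0" and \<beta>: "0 < \<beta>" "\<beta> < 1"
    and lip: "\<And>a x y. a \<in> \<alpha> \<Longrightarrow> x \<in> a \<Longrightarrow> y \<in> a \<Longrightarrow> \<bar>\<phi> x - \<phi> y\<bar> \<le> C * separation_dist T \<alpha> \<beta> x y"
    using potential_lipschitz by blast
  have *: "S w x \<le> S w y + C * (\<Sum>j\<le>length w. \<beta> ^ j)" if "w \<in> lists \<alpha>" "x \<in> X" "y \<in> X" for w x y
    using that(1)
  proof (induction w)
    case Nil
    then show ?case using C by (simp add: S_def birkhoff_sum_def)
  next
    case (Cons a w)
    then have w: "w \<in> lists \<alpha>" "a \<in> \<alpha>" by auto
    have "\<bar>\<phi> (binv (a # w) x) - \<phi> (binv (a # w) y)\<bar> \<le>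
        C * separation_dist T \<alpha> \<beta> (binv (a # w) x) (binv (a # w) y)"
      using w that by (intro lip[of a]) (auto simp: the_inv_into_in binv_closed)
    also have "\<dots> \<le> C * \<beta> ^ length (a # w)"
      using Cons.hyps that C w by (intro mult_left_mono separation_dist_cyl \<beta> binv_in_cyl) auto
    finally have "\<phi> (binv (a # w) x) \<le> \<phi> (binv (a # w) y) + C * \<beta> ^ length (a # w)"
      by linarith
    moreover have "C * (\<Sum>j\<le>length (a # w). \<beta> ^ j) =
        C * (\<Sum>j\<le>length w. \<beta> ^ j) + C * \<beta> ^ length (a # w)"
      by (simp add: distrib_left)
    ultimately show ?case
      using Cons.IH S_Cons[OF w(2,1) that(2)] S_Cons[OF w(2,1) that(3)] by linarith
  qed
  have "S w x \<le> S w y + C * (1 / (1 - \<beta>))" if "w \<in> lists \<alpha>" "x \<in> X" "y \<in> X" for w x y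
  proof -
    have "(\<Sum>j\<le>length w. \<beta> ^ j) \<le> (\<Sum>j. \<beta> ^ j)"
      using \<beta> by (intro sum_le_suminf summable_geometric) auto
    also have "\<dots> = 1 / (1 - \<beta>)" using \<beta> by (intro suminf_geometric) auto
    finally have "C * (\<Sum>j\<le>length w. \<beta> ^ j) \<le> C * (1 / (1 - \<beta>))"
      using C by (intro mult_left_mono) auto
    with *[OF that] show ?thesis by linarith
  qed
  then show thesis by (rule that)
qed

text \<open>The itinerary of such a point is \<open>w\<close> repeated forever, and points that are
  never separated coincide.\<close>

lemma periodic_unique:
  assumes "w \<in> lists \<alpha>" "w \<noteq> []" "x \<in> cyl w" "y \<in> cyl w"
    "(T ^^ length w) x = x" "(T ^^ length w) y = y"
  shows "x = y"
proof -
  have "separation_time T \<alpha> x y \<ge> enat n" for n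
  proof (rule separation_time_ge)
    fix j
    let ?n = "length w"
    have eq: "(T ^^ j) z = (T ^^ (j mod ?n)) z" if "(T ^^ ?n) z = z" for z
    proof -
      have "((T ^^ ?n) ^^ k) z = z" for k by (induction k) (auto simp: that)
      then have "(T ^^ (j mod ?n + ?n * (j div ?n))) z = (T ^^ (j mod ?n)) z"
        by (simp only: funpow_add funpow_mult[symmetric] comp_apply)
      then show ?thesis by simp
    qed
    have "(T ^^ j) z \<in> w ! (j mod ?n)" if "z \<in> cyl w" "(T ^^ ?n) z = z" for z
      by (subst eq[OF that(2)]) (use that(1) assms(2) in \<open>auto simp: cyl_def\<close>)
    moreover have "w ! (j mod ?n) \<in> \<alpha>" using assms(1,2) by (auto simp: in_lists_conv_set)
    ultimately show "\<exists>a\<in>\<alpha>. (T ^^ j) x \<in> a \<and> (T ^^ j) y \<in> a"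
      using assms(3-6) by blast
  qed
  then have "separation_time T \<alpha> x y = \<infinity>"
    by (cases "separation_time T \<alpha> x y") (auto, metis Suc_n_not_le_n)
  then show ?thesis using separating assms(3,4) by (auto simp: cyl_def)
qed

lemma concat_replicate_in_lists: "w \<in> lists A \<Longrightarrow> concat (replicate k w) \<in> lists A"
  by (induction k) auto

text \<open>Completeness provides a common point of the nested cylinders \<open>[w\<^sup>k]\<close>.\<close>

lemma periodic_exists:
  assumes w: "w \<in> lists \<alpha>" "w \<noteq> []"
  shows "\<exists>x\<in>cyl w. (T ^^ length w) x = x"
proof -
  let ?n = "length w" and ?\<beta> = "1/2 :: real"
  let ?r = "\<lambda>k. concat (replicate k w)"
  have len: "length (?r k) = k * ?n" for k by (induction k) auto
  have rl: "?r k \<in> lists \<alpha>" for k using w(1) by (rule concat_replicate_in_lists)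
  have T: "T \<in> X \<rightarrow> X" using T_closed by auto
  interpret d: Metric_space X "separation_dist T \<alpha> ?\<beta>"
    by (rule separation_dist_metric[OF partition(1) T separating]) auto
  obtain x0 where x0: "x0 \<in> X" using not_empty by auto
  \<comment> \<open>The itinerary of \<open>\<sigma> k\<close> starts with \<open>k\<close> copies
    of \<open>w\<close>, so later terms share ever longer prefixes and form a Cauchy
    sequence.\<close>
  define \<sigma> where "\<sigma> k = binv (?r k) x0" for k
  have \<sigma>: "\<sigma> k \<in> cyl (?r N)" if "N \<le> k" for k N
  proof -
    have "?r k = ?r N @ ?r (k - N)"
      using that by (simp add: concat_append[symmetric] replicate_add[symmetric] del: concat_append)
    then have "\<sigma> k = binv (?r N) (binv (?r (k - N)) x0)" by (simp add: \<sigma>_def branch_inv_append)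
    then show ?thesis using x0 rl by (simp add: binv_in_cyl binv_closed)
  qed
  have "d.MCauchy \<sigma>"
    unfolding d.MCauchy_def
  proof (intro conjI allI impI)
    show "range \<sigma> \<subseteq> X" using \<sigma>[of 0] by (auto simp: cyl_def)
    fix \<epsilon> :: real assume "\<epsilon> > 0"
    then obtain N where N: "?\<beta> ^ N < \<epsilon>" using real_arch_pow_inv[of \<epsilon> ?\<beta>] by auto
    show "\<exists>N. \<forall>n n'. N \<le> n \<longrightarrow> N \<le> n' \<longrightarrow> separation_dist T \<alpha> ?\<beta> (\<sigma> n) (\<sigma> n') < \<epsilon>"
    proof (intro exI allI impI)
      fix n n' assume "N \<le> n" "N \<le> n'"
      then have "separation_dist T \<alpha> ?\<beta> (\<sigma> n) (\<sigma> n') \<le> ?\<beta> ^ length (?r N)"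
        by (intro separation_dist_cyl rl \<sigma>) auto
      also have "\<dots> \<le> ?\<beta> ^ N" using w(2) by (intro power_decreasing) (auto simp: len Suc_le_eq)
      finally show "separation_dist T \<alpha> ?\<beta> (\<sigma> n) (\<sigma> n') < \<epsilon>" using N by simp
    qed
  qed
  moreover have "d.mcomplete" using complete[of ?\<beta>] by simp
  ultimately obtain x where x: "limitin d.mtopology \<sigma> x sequentially"
    by (auto simp: d.mcomplete_def)
  \<comment> \<open>Cylinders are closed in the following sense: once the distance from \<sigma> to
    its limit is below \<open>?\<beta> ^ length (?r k)\<close>, the two share the first
    letters.\<close>
  have xX: "x \<in> X" using x by (simp add: d.limitin_metric)
  have x_cyl: "x \<in> cyl (?r k)" for k
  proof -
    have "\<forall>\<^sub>F i in sequentially. \<sigma> i \<in> X \<and> separation_dist T \<alpha> ?\<beta> (\<sigma> i) x < ?\<beta> ^ length (?r k)"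
      using x by (simp add: d.limitin_metric)
    then have "\<forall>\<^sub>F i in sequentially. separation_dist T \<alpha> ?\<beta> (\<sigma> i) x < ?\<beta> ^ length (?r k) \<and> k \<le> i"
      using eventually_ge_at_top[of k] by eventually_elim auto
    then obtain i where i: "separation_dist T \<alpha> ?\<beta> (\<sigma> i) x < ?\<beta> ^ length (?r k)" "k \<le> i"
      by (auto dest: eventually_happens'[OF sequentially_bot])
    have "(T ^^ j) x \<in> ?r k ! j" if j: "j < length (?r k)" for j
    proof -
      obtain a where a: "a \<in> \<alpha>" "(T ^^ j) (\<sigma> i) \<in> a" "(T ^^ j) x \<in> a"
        using separation_dist_less_imp[of ?\<beta> "\<sigma> i" x "length (?r k)" j] i j by auto
      moreover have "(T ^^ j) (\<sigma> i) \<in> ?r k ! j" "?r k ! j \<in> \<alpha>"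
        using \<sigma>[OF i(2)] j rl[of k] by (auto simp: cyl_def in_lists_conv_set simp del: set_concat)
      ultimately show ?thesis using element_unique by blast
    qed
    then show ?thesis using xX by (simp add: cyl_def)
  qed
  \<comment> \<open>Dropping one copy of \<open>w\<close> leaves the infinite repetition unchanged,
    so the limit and its image under \<open>T ^^ ?n\<close> are never separated.\<close>
  have Tx_cyl: "(T ^^ ?n) x \<in> cyl (?r k)" for k
    using x_cyl[of "Suc k"] w(1) by (simp add: cyl_append)
  have "separation_time T \<alpha> ((T ^^ ?n) x) x \<ge> enat k" for k
  proof -
    have "enat k \<le> enat (length (?r k))" using w(2) by (simp add: len Suc_le_eq)
    also have "\<dots> \<le> separation_time T \<alpha> ((T ^^ ?n) x) x"
      by (rule separation_time_cyl[OF rl Tx_cyl x_cyl])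
    finally show ?thesis .
  qed
  then have "separation_time T \<alpha> ((T ^^ ?n) x) x = \<infinity>"
    by (cases "separation_time T \<alpha> ((T ^^ ?n) x) x") (auto, metis Suc_n_not_le_n)
  then have "(T ^^ ?n) x = x" using separating xX funpow_closed by auto
  moreover have "x \<in> cyl w" using x_cyl[of 1] by simp
  ultimately show ?thesis by auto
qed

end

section \<open>Measures of cylinders\<close>

context full_gibbs_markov
begin

lemma element_measurable: "a \<in> \<alpha> \<Longrightarrow> a \<in> sets M"
  using partition(3) by auto

lemma the_inv_into_vimage:
  "a \<in> \<alpha> \<Longrightarrow> the_inv_into a T -` B \<inter> X = T ` (B \<inter> a)"
  by (auto simp: the_inv_into_in T_the_inv_into the_inv_into_f_f inj_on_element element_subset T_closed
      intro!: rev_image_eqI[where x = "the_inv_into a T _"])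

lemma the_inv_into_measurable:
  assumes a: "a \<in> \<alpha>"
  shows "the_inv_into a T \<in> measurable M M"
proof (rule measurableI)
  show "the_inv_into a T x \<in> X" if "x \<in> X" for x
    using that a by (auto intro: element_subset the_inv_into_in)
  show "the_inv_into a T -` B \<inter> X \<in> sets M" if "B \<in> sets M" for B
    unfolding the_inv_into_vimage[OF a]
    using that a by (intro T_image_measurable) (auto intro: element_measurable)
qed

lemma the_inv_into_measurable_restrict:
  "a \<in> \<alpha> \<Longrightarrow> the_inv_into a T \<in> measurable M (restrict_space M a)"
  by (rule measurable_restrict_space2) (auto simp: the_inv_into_in intro: the_inv_into_measurable)

text \<open>The preimage under the inverse branch is the image under \<open>T\<close>, so \<mu>
  \<circ> T on \<open>a\<close> is a push-forward of \<mu>. In particular its defining set function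
  is a measure, and integrals against it can be transformed.\<close>

lemma measure_comp_on_eq_distr:
  assumes a: "a \<in> \<alpha>"
  shows "measure_comp_on M T a = distr M (restrict_space M a) (the_inv_into a T)"
proof -
  let ?R = "restrict_space M a" and ?N = "distr M (restrict_space M a) (the_inv_into a T)"
  have sp: "space ?R = a" using a element_measurable sets.sets_into_space by (auto simp: space_restrict_space)
  have "measure_comp_on M T a = measure_of (space ?N) (sets ?N) (emeasure ?N)"
    unfolding measure_comp_on_def space_distr sets_distr sp
  proof (rule measure_of_eq)
    show "sets ?R \<subseteq> Pow a" using sets.space_closed[of ?R] by (simp add: sp)
    fix B assume "B \<in> sigma_sets a (sets ?R)"
    then have B: "B \<in> sets ?R" using sets.sigma_sets_eq[of ?R] by (simp add: sp)
    then have "B \<subseteq> a" using sets.sets_into_space[OF B] by (simp add: sp)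
    then have "B \<inter> a = B" by auto
    then show "emeasure M (T ` B) = emeasure ?N B"
      using B by (simp add: emeasure_distr the_inv_into_measurable_restrict[OF a] the_inv_into_vimage[OF a])
  qed
  then show ?thesis by (simp only: measure_of_of_measure)
qed

text \<open>Change of variables on one full branch: on \<open>a\<close>, \<mu> has density
  \<open>exp \<phi>\<close> with respect to the push-forward of \<mu> under the inverse
  branch.\<close>

lemma nn_integral_element:
  assumes a: "a \<in> \<alpha>" and f: "f \<in> borel_measurable M"
  shows "(\<integral>\<^sup>+x. f x * indicator a x \<partial>M) =
    (\<integral>\<^sup>+x. f (the_inv_into a T x) * ennreal (exp (\<phi> (the_inv_into a T x))) \<partial>M)"
proof -
  note [measurable] = f potential_measurable the_inv_into_measurable_restrict[OF a]
  have "(\<integral>\<^sup>+x. f x * indicator a x \<partial>M) = (\<integral>\<^sup>+x. f x \<partial>restrict_space M a)"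
    using a element_measurable by (subst nn_integral_restrict_space) auto
  also have "\<dots> = (\<integral>\<^sup>+x. f x \<partial>density (distr M (restrict_space M a) (the_inv_into a T)) (\<lambda>x. ennreal (exp (\<phi> x))))"
    by (subst potential[OF a]) (simp add: measure_comp_on_eq_distr[OF a])
  also have "\<dots> = (\<integral>\<^sup>+x. ennreal (exp (\<phi> x)) * f x \<partial>distr M (restrict_space M a) (the_inv_into a T))"
    by (rule nn_integral_density)
      (auto intro!: measurable_restrict_space1 simp: measurable_distr_eq1)
  also have "\<dots> = (\<integral>\<^sup>+x. ennreal (exp (\<phi> (the_inv_into a T x))) * f (the_inv_into a T x) \<partial>M)"
    by (rule nn_integral_distr) (auto intro!: measurable_restrict_space1)
  finally show ?thesis by (simp add: mult.commute)
qed

lemma cyl_measurable: "w \<in> lists \<alpha> \<Longrightarrow> cyl w \<in> sets M"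
proof (induction w)
  case (Cons a w)
  then have a: "a \<in> \<alpha>" and w: "w \<in> lists \<alpha>" by auto
  have "cyl (a # w) = (T -` cyl w \<inter> X) \<inter> a"
    using a by (auto simp: cyl_Cons element_subset)
  then show ?case
    using Cons.IH[OF w] T_measurable element_measurable[OF a]
    by (auto intro: sets.Int measurable_sets)
qed (simp add: cyl_Nil)

text \<open>The first letter is removed by the one-branch formula; the induction hypothesis is then
  applied to the transformed integrand including its Jacobian.\<close>

lemma nn_integral_cyl:
  assumes w: "w \<in> lists \<alpha>" and f: "f \<in> borel_measurable M"
  shows "(\<integral>\<^sup>+x. f x * indicator (cyl w) x \<partial>M) = (\<integral>\<^sup>+x. f (binv w x) * ennreal (exp (S w x)) \<partial>M)"
  using w f
proof (induction w arbitrary: f)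
  case Nil
  then show ?case by (auto simp: S_def birkhoff_sum_def cyl_Nil intro!: nn_integral_cong)
next
  case (Cons a w)
  note a = Cons.hyps(1) and w = Cons.hyps(2)
  let ?i = "the_inv_into a T"
  note [measurable] = Cons.prems potential_measurable the_inv_into_measurable[OF a]
    cyl_measurable[OF w] cyl_measurable[OF lists.Cons[OF a w]]
  have "(\<integral>\<^sup>+x. f x * indicator (cyl (a # w)) x \<partial>M) =
      (\<integral>\<^sup>+x. (f x * indicator (cyl (a # w)) x) * indicator a x \<partial>M)"
    using a by (intro nn_integral_cong) (auto simp: cyl_Cons split: split_indicator)
  also have "\<dots> = (\<integral>\<^sup>+x. (f (?i x) * indicator (cyl (a # w)) (?i x)) * ennreal (exp (\<phi> (?i x))) \<partial>M)"
    by (rule nn_integral_element[OF a]) measurable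
  also have "\<dots> = (\<integral>\<^sup>+x. (f (?i x) * ennreal (exp (\<phi> (?i x)))) * indicator (cyl w) x \<partial>M)"
    using a by (intro nn_integral_cong)
      (auto simp: cyl_Cons the_inv_into_in T_the_inv_into split: split_indicator)
  also have "\<dots> = (\<integral>\<^sup>+x. (f (?i (binv w x)) * ennreal (exp (\<phi> (?i (binv w x))))) * ennreal (exp (S w x)) \<partial>M)"
    by (rule Cons.IH) measurable
  also have "\<dots> = (\<integral>\<^sup>+x. f (binv (a # w) x) * ennreal (exp (S (a # w) x)) \<partial>M)"
    using a w by (intro nn_integral_cong) (simp add: S_Cons exp_add ennreal_mult mult.assoc)
  finally show ?case .
qed

lemma emeasure_cyl: "w \<in> lists \<alpha> \<Longrightarrow> emeasure M (cyl w) = (\<integral>\<^sup>+x. ennreal (exp (S w x)) \<partial>M)"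
  using nn_integral_cyl[of w "\<lambda>x. 1"] cyl_measurable[of w] by simp

text \<open>The measure of \<open>[w]\<close> is the average of \<open>exp (S w)\<close> over a
  probability space, and this function is constant up to the factor \<open>exp D\<close>.\<close>

lemma emeasure_cyl_bounds:
  assumes D: "\<forall>w\<in>lists \<alpha>. \<forall>x\<in>X. \<forall>y\<in>X. S w x \<le> S w y + D"
    and w: "w \<in> lists \<alpha>" and x: "x \<in> X"
  shows "emeasure M (cyl w) \<le> ennreal (exp D) * ennreal (exp (S w x))"
    and "ennreal (exp (S w x)) \<le> ennreal (exp D) * emeasure M (cyl w)"
proof -
  have "emeasure M (cyl w) \<le> (\<integral>\<^sup>+y. ennreal (exp (D + S w x)) \<partial>M)"
    unfolding emeasure_cyl[OF w] using D w x
    by (intro nn_integral_mono ennreal_leI) (simp add: add.commute)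
  then show "emeasure M (cyl w) \<le> ennreal (exp D) * ennreal (exp (S w x))"
    by (simp add: emeasure_space_1 exp_add ennreal_mult)
  have "(\<integral>\<^sup>+y. ennreal (exp (S w x - D)) \<partial>M) \<le> emeasure M (cyl w)"
    unfolding emeasure_cyl[OF w] using D w x
    by (intro nn_integral_mono ennreal_leI) (simp add: algebra_simps)
  then have "ennreal (exp D) * ennreal (exp (S w x - D)) \<le> ennreal (exp D) * emeasure M (cyl w)"
    by (intro mult_left_mono) (auto simp: emeasure_space_1)
  then show "ennreal (exp (S w x)) \<le> ennreal (exp D) * emeasure M (cyl w)"
    by (simp add: ennreal_mult[symmetric] exp_add[symmetric])
qed

lemma emeasure_cyl_total: "infsum (\<lambda>w. emeasure M (cyl w)) (words \<alpha> n) = 1"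
proof -
  have c: "countable (words \<alpha> n)"
    by (rule countable_subset[OF _ countable_lists[OF partition(2)]]) (auto simp: words_def)
  have "infsum (\<lambda>w. emeasure M (cyl w)) (words \<alpha> n) =
      (\<integral>\<^sup>+w. emeasure M (cyl w) \<partial>count_space (words \<alpha> n))"
    by (rule infsum_eq_nn_integral_count_space[OF c])
  also have "\<dots> = emeasure M (\<Union>w\<in>words \<alpha> n. cyl w)"
    using word_unique[of _ n]
    by (intro emeasure_UN_countable[symmetric] c)
      (auto simp: disjoint_family_on_def intro!: cyl_measurable words_lists)
  also have "(\<Union>w\<in>words \<alpha> n. cyl w) = X"
    using word_exists[of _ n] by (auto simp: cyl_subset)
  finally show ?thesis by (simp add: emeasure_space_1)
qed

end

section \<open>Group extensions\<close>

locale full_gibbs_markov_extension = full_gibbs_markov M T \<alpha> \<phi> TX + group G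
  for M :: "'x measure" and T \<alpha> \<phi> TX and G :: "('g, 'b) monoid_scheme" (structure) +
  fixes \<psi> :: "'x \<Rightarrow> 'g"
  assumes \<psi>_closed: "\<psi> \<in> space M \<rightarrow> carrier G"
    and \<psi>_const: "\<And>a x y. a \<in> \<alpha> \<Longrightarrow> x \<in> a \<Longrightarrow> y \<in> a \<Longrightarrow> \<psi> x = \<psi> y"
    and transitive: "topologically_transitive (prod_topology TX (discrete_topology (carrier G)))
      (group_extension G T \<psi>)"
begin

definition \<theta> :: "'x set \<Rightarrow> 'g" where
  "\<theta> a = \<psi> (SOME x. x \<in> a)"

lemma \<psi>_in: "x \<in> X \<Longrightarrow> \<psi> x \<in> carrier G"
  using \<psi>_closed by (rule funcset_mem)

lemma \<theta>_eq: "a \<in> \<alpha> \<Longrightarrow> x \<in> a \<Longrightarrow> \<theta> a = \<psi> x"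
  unfolding \<theta>_def by (rule \<psi>_const) (auto intro: someI)

lemma cocycle_closed: "x \<in> X \<Longrightarrow> cocycle G T \<psi> n x \<in> carrier G"
  by (induction n) (auto simp: \<psi>_in funpow_closed)

text \<open>The definition splits off the last step of the orbit on the left; words grow at the
  front and need the first step split off on the right.\<close>

lemma cocycle_Suc: "x \<in> X \<Longrightarrow> cocycle G T \<psi> (Suc n) x = cocycle G T \<psi> n (T x) \<otimes> \<psi> x"
proof (induction n)
  case 0
  then show ?case by (simp add: \<psi>_in)
next
  case (Suc n)
  have "cocycle G T \<psi> (Suc (Suc n)) x = \<psi> ((T ^^ Suc n) x) \<otimes> cocycle G T \<psi> (Suc n) x" by simp
  also have "\<dots> = \<psi> ((T ^^ Suc n) x) \<otimes> (cocycle G T \<psi> n (T x) \<otimes> \<psi> x)"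
    using Suc.IH[OF Suc.prems] by (rule arg_cong)
  also have "\<dots> = (\<psi> ((T ^^ Suc n) x) \<otimes> cocycle G T \<psi> n (T x)) \<otimes> \<psi> x"
    by (intro m_assoc[symmetric] cocycle_closed T_closed \<psi>_in funpow_closed Suc.prems)
  also have "\<psi> ((T ^^ Suc n) x) \<otimes> cocycle G T \<psi> n (T x) = cocycle G T \<psi> (Suc n) (T x)"
    by (simp add: funpow_swap1)
  finally show ?case .
qed

lemma cocycle_cyl: "w \<in> lists \<alpha> \<Longrightarrow> x \<in> cyl w \<Longrightarrow> cocycle G T \<psi> (length w) x = word_val G \<theta> w"
proof (induction w arbitrary: x)
  case (Cons a w)
  then have a: "a \<in> \<alpha>" and w: "w \<in> lists \<alpha>" and x: "x \<in> a" "T x \<in> cyl w"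
    by (auto simp: cyl_Cons)
  have "cocycle G T \<psi> (Suc (length w)) x = cocycle G T \<psi> (length w) (T x) \<otimes> \<psi> x"
    by (rule cocycle_Suc) (rule element_subset[OF a x(1)])
  then show ?case using Cons.IH[OF w x(2)] \<theta>_eq[OF a x(1)] by simp
qed simp

lemma topspace_TX: "topspace TX = X"
proof -
  have T: "T \<in> X \<rightarrow> X" using T_closed by auto
  interpret d: Metric_space X "separation_dist T \<alpha> (1/2)"
    by (rule separation_dist_metric[OF partition(1) T separating]) auto
  show ?thesis using topology[of "1/2"] d.topspace_mtopology by simp
qed

lemma group_extension_funpow:
  "x \<in> X \<Longrightarrow> g \<in> carrier G \<Longrightarrow>
    (group_extension G T \<psi> ^^ n) (x, g) = ((T ^^ n) x, cocycle G T \<psi> n x \<otimes> g)"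
proof (induction n)
  case (Suc n)
  have "\<psi> ((T ^^ n) x) \<in> carrier G" by (intro \<psi>_in funpow_closed Suc.prems(1))
  then show ?case
    using Suc by (simp add: group_extension_def m_assoc cocycle_closed)
qed simp

text \<open>Transitivity is applied to the open slices over \<one> and over \<open>g\<close>: an
  orbit from the first to the second has cocycle value \<open>g\<close>, and its itinerary is the
  required word.\<close>

lemma word_val_reach:
  assumes g: "g \<in> carrier G"
  shows "\<exists>w\<in>lists \<alpha>. word_val G \<theta> w = g"
proof -
  let ?P = "prod_topology TX (discrete_topology (carrier G))"
  have "openin ?P (X \<times> {h}) \<and> X \<times> {h} \<noteq> {}" if "h \<in> carrier G" for h
    using that not_empty openin_topspace[of TX] by (simp add: openin_prod_Times_iff topspace_TX)
  then obtain n where "(group_extension G T \<psi> ^^ n) ` (X \<times> {\<one>}) \<inter> X \<times> {g} \<noteq> {}"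
    using transitive g unfolding topologically_transitive_def by (metis one_closed)
  then obtain z where z: "z \<in> X \<times> {\<one>}" "(group_extension G T \<psi> ^^ n) z \<in> X \<times> {g}"
    unfolding ex_in_conv[symmetric] by (elim exE IntE imageE) (simp only:)
  from z(1) obtain x where "x \<in> X" "z = (x, \<one>)" by auto
  with z(2) have x: "x \<in> X" "cocycle G T \<psi> n x = g"
    by (simp_all add: group_extension_funpow cocycle_closed)
  obtain w where w: "w \<in> words \<alpha> n" "x \<in> cyl w" using word_exists[OF x(1)] by blast
  then have "word_val G \<theta> w = g"
    using cocycle_cyl[of w x] x(2) by (simp add: words_def)
  then show ?thesis using w by (auto simp: words_def)
qed

text \<open>With \<open>exp (S w x)\<close> the chain rule is exact; each of the three passages
  between it and a cylinder measure costs a factor \<open>exp D\<close>, hence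
  \<open>exp (3 * D)\<close>.\<close>

lemma distortion_word_weights:
  assumes D: "\<forall>w\<in>lists \<alpha>. \<forall>x\<in>X. \<forall>y\<in>X. S w x \<le> S w y + D"
  shows "word_weights G \<alpha> (\<lambda>w. emeasure M (cyl w)) (exp (3 * D)) \<theta>"
proof unfold_locales
  obtain x where x: "x \<in> X" using not_empty by auto
  let ?e = "\<lambda>r. ennreal (exp r)"
  have e: "?e (3 * D) = ?e D * (?e D * ?e D)"
    by (simp add: ennreal_mult[symmetric] exp_add[symmetric])
  have S: "?e (S (u @ v) x) = ?e (S u (binv v x)) * ?e (S v x)"
    if "u \<in> lists \<alpha>" "v \<in> lists \<alpha>" for u v
    using that x by (simp add: S_append exp_add ennreal_mult)
  note upper = emeasure_cyl_bounds(1)[OF D] and lower = emeasure_cyl_bounds(2)[OF D]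
  show "exp (3 * D) > 0" by simp
  show "0 < emeasure M (cyl w)" if w: "w \<in> lists \<alpha>" for w
    using lower[OF w x] by (intro gr_zeroI) (auto simp: ennreal_eq_0_iff not_le)
  show "infsum (\<lambda>w. emeasure M (cyl w)) (words \<alpha> n) = 1" for n by (rule emeasure_cyl_total)
  show "\<theta> a \<in> carrier G" if a: "a \<in> \<alpha>" for a
  proof -
    have "the_inv_into a T x \<in> a" using a x by (rule the_inv_into_in)
    then show ?thesis using \<theta>_eq[OF a] element_subset[OF a] \<psi>_in by auto
  qed
  show "\<exists>w\<in>lists \<alpha>. word_val G \<theta> w = g" if "g \<in> carrier G" for g
    using that by (rule word_val_reach)
  fix u v assume u: "u \<in> lists \<alpha>" and v: "v \<in> lists \<alpha>"
  have uv: "u @ v \<in> lists \<alpha>" using u v by auto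
  have bv: "binv v x \<in> X" using v x by (rule binv_closed)
  have "emeasure M (cyl u) * emeasure M (cyl v) \<le> (?e D * ?e (S u (binv v x))) * (?e D * ?e (S v x))"
    using u v x bv by (intro mult_mono upper) auto
  also have "\<dots> = (?e D * ?e D) * ?e (S (u @ v) x)" by (simp add: S[OF u v] mult_ac)
  also have "\<dots> \<le> (?e D * ?e D) * (?e D * emeasure M (cyl (u @ v)))"
    by (intro mult_left_mono lower uv x) auto
  finally show "emeasure M (cyl u) * emeasure M (cyl v) \<le> ?e (3 * D) * emeasure M (cyl (u @ v))"
    unfolding e by (simp only: mult_ac)
  have "emeasure M (cyl (u @ v)) \<le> ?e D * (?e (S u (binv v x)) * ?e (S v x))"
    using upper[OF uv x] by (simp only: S[OF u v])
  also have "\<dots> \<le> ?e D * ((?e D * emeasure M (cyl u)) * (?e D * emeasure M (cyl v)))"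
    using u v x bv by (intro mult_left_mono mult_mono lower) auto
  finally show "emeasure M (cyl (u @ v)) \<le> ?e (3 * D) * (emeasure M (cyl u) * emeasure M (cyl v))"
    unfolding e by (simp only: mult_ac)
qed

text \<open>A constant chosen once and for all, so that it can be a parameter of the sublocale
  below.\<close>

definition distortion :: real where
  "distortion = (SOME D. \<forall>w\<in>lists \<alpha>. \<forall>x\<in>X. \<forall>y\<in>X. S w x \<le> S w y + D)"

lemma S_distortion: "\<forall>w\<in>lists \<alpha>. \<forall>x\<in>X. \<forall>y\<in>X. S w x \<le> S w y + distortion"
proof -
  have "\<exists>D. \<forall>w\<in>lists \<alpha>. \<forall>x\<in>X. \<forall>y\<in>X. S w x \<le> S w y + D"
    using bounded_distortion by metis
  then show ?thesis unfolding distortion_def by (rule someI_ex)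
qed

abbreviation p :: "'x set list \<Rightarrow> ennreal" where
  "p w \<equiv> emeasure M (cyl w)"

sublocale W: word_weights G \<alpha> "\<lambda>w. emeasure M (cyl w)" "exp (3 * distortion)" \<theta>
  by (rule distortion_word_weights) (rule S_distortion)

lemmas p_upper = emeasure_cyl_bounds(1)[OF S_distortion]
  and p_lower = emeasure_cyl_bounds(2)[OF S_distortion]

section \<open>Pressures as growth rates over words\<close>

lemma birkhoff_sum_cyl:
  "w \<in> lists \<alpha> \<Longrightarrow> x \<in> cyl w \<Longrightarrow> birkhoff_sum T \<phi> (length w) x = S w ((T ^^ length w) x)"
  by (simp add: S_def binv_funpow)

text \<open>For \<open>n > 0\<close> each cylinder of length \<open>n\<close> contains exactly one
  fixed point of \<open>T ^^ n\<close>. Itineraries and periodic points thus give injections both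
  ways, and the weights agree up to the distortion factor.\<close>

lemma weighted_growth_eq:
  assumes PR: "\<And>n w x. n > 0 \<Longrightarrow> w \<in> words \<alpha> n \<Longrightarrow> x \<in> cyl w \<Longrightarrow> x \<in> E n \<longleftrightarrow> (T ^^ n) x = x \<and> R w"
    and E: "\<And>n. E n \<subseteq> X"
  shows "weighted_growth T \<phi> E = growth (\<lambda>n. infsum p {w\<in>words \<alpha> n. R w})"
proof -
  let ?A = "\<lambda>n. \<Sum>\<^sub>\<infinity>x\<in>E n. ennreal (exp (birkhoff_sum T \<phi> n x))"
  let ?B = "\<lambda>n. infsum p {w\<in>words \<alpha> n. R w}" and ?D = "ennreal (exp distortion)"
  have S_bounds: "ennreal (exp (birkhoff_sum T \<phi> n x)) \<le> ?D * p w"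
    "p w \<le> ?D * ennreal (exp (birkhoff_sum T \<phi> n x))"
    if "w \<in> words \<alpha> n" "x \<in> cyl w" for w n x
    using that p_lower[of w "(T ^^ length w) x"] p_upper[of w "(T ^^ length w) x"]
    by (auto simp: words_def birkhoff_sum_cyl cyl_subset funpow_closed)
  have "?A n \<le> ?D * ?B n" if n: "n > 0" for n
  proof -
    define it where "it x = (SOME w. w \<in> words \<alpha> n \<and> x \<in> cyl w)" for x
    have it: "it x \<in> words \<alpha> n" "x \<in> cyl (it x)" if "x \<in> E n" for x
    proof -
      have "\<exists>w. w \<in> words \<alpha> n \<and> x \<in> cyl w" using word_exists that E by blast
      then have "it x \<in> words \<alpha> n \<and> x \<in> cyl (it x)" unfolding it_def by (rule someI_ex)
      then show "it x \<in> words \<alpha> n" "x \<in> cyl (it x)" by auto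
    qed
    have Rit: "(T ^^ n) x = x \<and> R (it x)" if "x \<in> E n" for x
      using PR[OF n it[OF that]] that by simp
    show ?thesis
      unfolding infsum_ennreal_cmult[symmetric]
    proof (rule infsum_ennreal_inj_le[where h = it])
      show "inj_on it (E n)"
      proof (rule inj_onI)
        fix x y assume xy: "x \<in> E n" "y \<in> E n" "it x = it y"
        have w: "it x \<in> lists \<alpha>" "length (it x) = n"
          using it(1)[OF xy(1)] by (simp_all add: words_def)
        have y: "y \<in> cyl (it x)" unfolding xy(3) by (rule it(2)[OF xy(2)])
        show "x = y"
          by (rule periodic_unique[OF w(1) _ it(2)[OF xy(1)] y])
            (use w(2) n Rit[OF xy(1)] Rit[OF xy(2)] in auto)
      qed
    qed (use it Rit in \<open>auto intro!: S_bounds\<close>)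
  qed
  then have le: "weighted_growth T \<phi> E \<le> growth ?B"
    using growth_le_shift[of ?A ?D ?B 0] eventually_gt_at_top[of "0::nat"]
    by (simp add: weighted_growth_def growth_def eventually_mono)
  have "?B n \<le> ?D * ?A n" if n: "n > 0" for n
  proof -
    define per where "per w = (SOME x. x \<in> cyl w \<and> (T ^^ n) x = x)" for w
    have per: "per w \<in> cyl w" "(T ^^ n) (per w) = per w" if "w \<in> words \<alpha> n" for w
    proof -
      have "\<exists>x. x \<in> cyl w \<and> (T ^^ n) x = x"
        using periodic_exists[of w] that n by (auto simp: words_def)
      then have "per w \<in> cyl w \<and> (T ^^ n) (per w) = per w" unfolding per_def by (rule someI_ex)
      then show "per w \<in> cyl w" "(T ^^ n) (per w) = per w" by auto
    qed
    have perE: "per w \<in> E n" if "w \<in> words \<alpha> n" "R w" for w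
      using PR[OF n that(1) per(1)[OF that(1)]] per(2)[OF that(1)] that(2) by simp
    show ?thesis
      unfolding infsum_ennreal_cmult[symmetric]
    proof (rule infsum_ennreal_inj_le[where h = per])
      show "inj_on per {w \<in> words \<alpha> n. R w}"
      proof (rule inj_onI)
        fix u v assume "u \<in> {w \<in> words \<alpha> n. R w}" "v \<in> {w \<in> words \<alpha> n. R w}" "per u = per v"
        then show "u = v" using per(1)[of u] per(1)[of v] word_unique[of u n v "per u"] by simp
      qed
    qed (use per perE in \<open>auto intro!: S_bounds\<close>)
  qed
  then have "growth ?B \<le> weighted_growth T \<phi> E"
    using growth_le_shift[of ?B ?D ?A 0] eventually_gt_at_top[of "0::nat"]
    by (simp add: weighted_growth_def growth_def eventually_mono)
  with le show ?thesis by (rule antisym)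
qed

lemma in_element_iff_take:
  assumes "n > 0" "w \<in> words \<alpha> n" "x \<in> cyl w" "a \<in> \<alpha>"
  shows "x \<in> a \<longleftrightarrow> take (length [a]) w = [a]"
proof -
  obtain b v where w: "w = b # v" "b \<in> \<alpha>"
    using assms(1,2) by (cases w) (auto simp: words_def)
  then have "x \<in> b" using assms(3) by (simp add: cyl_Cons)
  then show ?thesis using w assms(4) element_unique[of a b x] by auto
qed

lemma cocycle_words:
  "w \<in> words \<alpha> n \<Longrightarrow> x \<in> cyl w \<Longrightarrow> cocycle G T \<psi> n x = word_val G \<theta> w"
  using cocycle_cyl[of w x] by (simp add: words_def)

lemma base_pressure_eq:
  assumes a: "a \<in> \<alpha>"
  shows "base_pressure T \<phi> a = 0"
proof -
  have "base_pressure T \<phi> a = growth (\<lambda>n. infsum p {w\<in>words \<alpha> n. take (length [a]) w = [a]})"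
    unfolding base_pressure_def
    using in_element_iff_take[OF _ _ _ a] element_subset[OF a] by (intro weighted_growth_eq) auto
  then show ?thesis using W.growth_prefix[of "[a]"] a by simp
qed

lemma extension_pressure_eq:
  assumes a: "a \<in> \<alpha>" and g: "g \<in> carrier G"
  shows "extension_pressure G T \<phi> \<psi> a g = W.pressure"
proof -
  have "extension_pressure G T \<phi> \<psi> a g =
      growth (\<lambda>n. infsum p {w\<in>words \<alpha> n. take (length [a]) w = [a] \<and> word_val G \<theta> w = g})"
    unfolding extension_pressure_def
    using in_element_iff_take[OF _ _ _ a] element_subset[OF a]
    by (intro weighted_growth_eq) (auto simp: cocycle_words)
  then show ?thesis using W.growth_prefix_val[of "[a]" g] a g by simp
qed

lemma ab_extension_pressure_eq:
  assumes a: "a \<in> \<alpha>" and k: "k \<in> carrier (free_abelianization G)" and am: "amenable G"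
  shows "ab_extension_pressure G T \<phi> \<psi> a k = W.pressure"
proof -
  have "ab_extension_pressure G T \<phi> \<psi> a k =
      growth (\<lambda>n. infsum p {w\<in>words \<alpha> n. take (length [a]) w = [a] \<and> free_ab_proj G (word_val G \<theta> w) = k})"
    unfolding ab_extension_pressure_def
    using in_element_iff_take[OF _ _ _ a] element_subset[OF a]
    by (intro weighted_growth_eq) (auto simp: cocycle_words)
  then show ?thesis using W.growth_prefix_free_ab[OF am, of "[a]" k] a k by simp
qed

section \<open>Return cylinders and the measures \<open>m_n\<close>\<close>

lemma inj_on_cyl_words: "inj_on cyl (words \<alpha> n)"
proof (rule inj_onI)
  fix u v assume uv: "u \<in> words \<alpha> n" "v \<in> words \<alpha> n" "cyl u = cyl v"
  obtain x where "x \<in> X" using not_empty by auto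
  then have "binv u x \<in> cyl u" using uv by (intro binv_in_cyl) (auto simp: words_def)
  then show "u = v" using uv word_unique[of u n v "binv u x"] by simp
qed

text \<open>Cylinders of equal length are disjoint or equal and all have positive measure, so
  inclusion modulo \<mu> is a prefix condition. The return set is \<open>cyl (w @ c)\<close>, again
  of positive measure.\<close>

lemma return_cylinders_eq:
  assumes c: "c \<in> words \<alpha> m" and n: "m \<le> n"
  shows "return_cylinders M T \<alpha> (cyl c) n = cyl ` {w\<in>words \<alpha> n. take (length c) w = c}"
proof -
  have cl: "c \<in> lists \<alpha>" "length c = m" using c by (auto simp: words_def)
  have "emeasure M (sym_diff (cyl w \<inter> cyl c) (cyl w)) = 0 \<and> emeasure M (cyl w \<inter> (T ^^ n) -` cyl c) > 0
      \<longleftrightarrow> take (length c) w = c" if w: "w \<in> words \<alpha> n" for w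
  proof -
    have wl: "w \<in> lists \<alpha>" "length w = n" using w by (auto simp: words_def)
    have split: "take m w \<in> words \<alpha> m" "cyl w \<subseteq> cyl (take m w)"
      using wl n by (auto simp: words_def cyl_def in_lists_conv_set dest: in_set_takeD)
    have "cyl w \<inter> (T ^^ n) -` cyl c = cyl (w @ c)"
      using wl by (auto simp: cyl_append)
    then have pos: "emeasure M (cyl w \<inter> (T ^^ n) -` cyl c) > 0"
      using W.p_pos[of "w @ c"] wl cl by auto
    show ?thesis
    proof (cases "take m w = c")
      case True
      then have "sym_diff (cyl w \<inter> cyl c) (cyl w) = {}" using split by auto
      then have "emeasure M (sym_diff (cyl w \<inter> cyl c) (cyl w)) = 0" by (simp only: emeasure_empty)
      then show ?thesis 
        using True cl(2) pos by (intro iffI conjI) simp_all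
    next
      case False
      have "cyl w \<inter> cyl c = {}"
        using False word_unique[OF split(1) c] split(2) by auto
      then show ?thesis using W.p_pos[OF wl(1)] False cl(2) by simp
    qed
  qed
  then show ?thesis
    by (auto simp: return_cylinders_def cylinders_eq)
qed

lemma branch_weight_eq:
  "w \<in> words \<alpha> n \<Longrightarrow> \<xi> \<in> X \<Longrightarrow> branch_weight T \<phi> \<xi> n (cyl w) = ennreal (exp (S w \<xi>))"
  using the_inv_into_cyl[of w \<xi>] by (auto simp: branch_weight_def S_def words_def)

lemma return_measure_eq:
  assumes c: "c \<in> words \<alpha> m" and n: "m \<le> n" and \<xi>: "\<xi> \<in> X"
  shows "return_measure M T \<alpha> \<phi> G \<psi> (cyl c) \<xi> n g =
    infsum (\<lambda>w. ennreal (exp (S w \<xi>))) {w\<in>words \<alpha> n. take (length c) w = c \<and> word_val G \<theta> w = g} /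
    infsum (\<lambda>w. ennreal (exp (S w \<xi>))) {w\<in>words \<alpha> n. take (length c) w = c}"
proof -
  have sum: "infsum (branch_weight T \<phi> \<xi> n) (cyl ` U) = infsum (\<lambda>w. ennreal (exp (S w \<xi>))) U"
    if U: "U \<subseteq> words \<alpha> n" for U
  proof -
    have "infsum (branch_weight T \<phi> \<xi> n) (cyl ` U) = infsum (branch_weight T \<phi> \<xi> n \<circ> cyl) U"
      by (rule infsum_reindex) (rule inj_on_subset[OF inj_on_cyl_words U])
    also have "\<dots> = infsum (\<lambda>w. ennreal (exp (S w \<xi>))) U"
      using U \<xi> by (intro infsum_cong) (auto simp: branch_weight_eq)
    finally show ?thesis .
  qed
  have const: "(\<forall>x\<in>cyl w. cocycle G T \<psi> n x = g) \<longleftrightarrow> word_val G \<theta> w = g" if w: "w \<in> words \<alpha> n" for w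
  proof -
    have "binv w \<xi> \<in> cyl w" using w \<xi> by (intro binv_in_cyl) (auto simp: words_def)
    then show ?thesis using cocycle_words[OF w] by auto
  qed
  have "{v \<in> return_cylinders M T \<alpha> (cyl c) n. \<forall>x\<in>v. cocycle G T \<psi> n x = g} =
      cyl ` {w\<in>words \<alpha> n. take (length c) w = c \<and> word_val G \<theta> w = g}"
    unfolding return_cylinders_eq[OF c n] using const by auto
  then show ?thesis
    unfolding return_measure_def by (simp add: return_cylinders_eq[OF c n] sum)
qed

text \<open>Numerators compare with sums of \<open>p\<close> by distortion. Denominators are bounded
  above by the total weight 1 and below by \<open>prefix_total_ge\<close>, up to factors independent
  of \<open>n\<close>.\<close>

lemma return_measure_bounds:
  assumes c: "c \<in> words \<alpha> m" and \<xi>: "\<xi> \<in> X"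
  obtains C D where "C > 0"
    "\<And>n g. m \<le> n \<Longrightarrow> return_measure M T \<alpha> \<phi> G \<psi> (cyl c) \<xi> n g \<le> ennreal C * W.Z n g"
    "\<And>n. m \<le> n \<Longrightarrow> infsum p {w\<in>words \<alpha> n. take (length c) w = c \<and> word_val G \<theta> w = \<one>} \<le>
      ennreal D * return_measure M T \<alpha> \<phi> G \<psi> (cyl c) \<xi> n \<one>"
proof -
  have cl: "c \<in> lists \<alpha>" "length c = m" using c by (auto simp: words_def)
  let ?d = "exp distortion" and ?K = "exp (3 * distortion)"
  let ?num = "\<lambda>n g. infsum (\<lambda>w. ennreal (exp (S w \<xi>))) {w\<in>words \<alpha> n. take (length c) w = c \<and> word_val G \<theta> w = g}"
  let ?den = "\<lambda>n. infsum (\<lambda>w. ennreal (exp (S w \<xi>))) {w\<in>words \<alpha> n. take (length c) w = c}"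
  define pc where "pc = enn2real (p c)"
  have pc: "pc > 0" "p c = ennreal pc"
    using W.p_pos[OF cl(1)] W.p_finite[OF cl(1)] by (auto simp: pc_def enn2real_positive_iff less_top)
  have upper: "infsum (\<lambda>w. ennreal (exp (S w \<xi>))) U \<le> ennreal ?d * infsum p U"
    and lower: "infsum p U \<le> ennreal ?d * infsum (\<lambda>w. ennreal (exp (S w \<xi>))) U"
    if "U \<subseteq> words \<alpha> n" for U n
    unfolding infsum_ennreal_cmult[symmetric] using that \<xi>
    by (auto intro!: infsum_ennreal_mono p_lower p_upper simp: words_def)
  have den_le: "?den n \<le> ennreal ?d" for n
  proof -
    have "?den n \<le> ennreal ?d * infsum p {w\<in>words \<alpha> n. take (length c) w = c}"
      by (rule upper) auto
    also have "\<dots> \<le> ennreal ?d * infsum p (words \<alpha> n)"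
      by (intro mult_left_mono infsum_ennreal_mono_set) auto
    finally show ?thesis by (simp add: emeasure_cyl_total)
  qed
  have den_ge: "1 \<le> ennreal (?K / pc * ?d) * ?den n" if n: "m \<le> n" for n
  proof -
    have "1 \<le> ennreal ?K * inverse (p c) * infsum p {w\<in>words \<alpha> n. take (length c) w = c}"
      by (rule W.prefix_total_ge) (use cl n in auto)
    also have "\<dots> \<le> ennreal ?K * inverse (p c) * (ennreal ?d * ?den n)"
      by (intro mult_left_mono lower) auto
    also have "\<dots> = ennreal (?K / pc * ?d) * ?den n"
      using pc by (simp add: inverse_ennreal ennreal_mult divide_inverse mult_ac)
    finally show ?thesis .
  qed
  show thesis
  proof (rule that)
    \<comment> \<open>The factor \<open>?K / pc * ?d\<close> comes from the denominator, the last
      \<open>?d\<close> from the numerator.\<close>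
    show "?K / pc * ?d * ?d > 0" using pc by simp
    fix n assume n: "m \<le> n"
    \<comment> \<open>Division in \<open>ennreal\<close> cancels only for a denominator that is
      neither 0 nor infinite.\<close>
    have den: "?den n \<noteq> 0" "?den n \<noteq> \<infinity>" using den_ge[OF n] den_le[of n] by (auto simp: top_unique)
    have md: "return_measure M T \<alpha> \<phi> G \<psi> (cyl c) \<xi> n g * ?den n = ?num n g" for g
      unfolding return_measure_eq[OF c n \<xi>] ennreal_divide_times using den
      by (simp add: ennreal_divide_self less_top)
    show "return_measure M T \<alpha> \<phi> G \<psi> (cyl c) \<xi> n g \<le> ennreal (?K / pc * ?d * ?d) * W.Z n g" for g
    proof -
      let ?m = "return_measure M T \<alpha> \<phi> G \<psi> (cyl c) \<xi> n g"
      have "?m * 1 \<le> ?m * (ennreal (?K / pc * ?d) * ?den n)"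
        by (intro mult_left_mono den_ge n) auto
      also have "\<dots> = ennreal (?K / pc * ?d) * ?num n g" by (simp only: md[symmetric] mult_ac)
      also have "\<dots> \<le> ennreal (?K / pc * ?d) *
          (ennreal ?d * infsum p {w\<in>words \<alpha> n. take (length c) w = c \<and> word_val G \<theta> w = g})"
        by (intro mult_left_mono upper) auto
      also have "\<dots> \<le> ennreal (?K / pc * ?d) * (ennreal ?d * W.Z n g)"
        unfolding W.Z_def by (intro mult_left_mono infsum_ennreal_mono_set) auto
      also have "\<dots> = ennreal (?K / pc * ?d * ?d) * W.Z n g"
      proof -
        have "ennreal (?K / pc * ?d * ?d) = ennreal (?K / pc * ?d) * ennreal ?d"
          using pc by (intro ennreal_mult) auto
        then show ?thesis by (simp only: mult_ac)
      qed
      finally show ?thesis by simp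
    qed
    have "infsum p {w\<in>words \<alpha> n. take (length c) w = c \<and> word_val G \<theta> w = \<one>} \<le> ennreal ?d * ?num n \<one>"
      by (rule lower) auto
    also have "\<dots> = ennreal ?d * (return_measure M T \<alpha> \<phi> G \<psi> (cyl c) \<xi> n \<one> * ?den n)"
      by (simp only: md)
    also have "\<dots> \<le> ennreal ?d * (return_measure M T \<alpha> \<phi> G \<psi> (cyl c) \<xi> n \<one> * ennreal ?d)"
      by (intro mult_left_mono den_le) auto
    also have "\<dots> = ennreal (?d * ?d) * return_measure M T \<alpha> \<phi> G \<psi> (cyl c) \<xi> n \<one>"
      by (simp add: ennreal_mult mult_ac)
    finally show "infsum p {w\<in>words \<alpha> n. take (length c) w = c \<and> word_val G \<theta> w = \<one>} \<le>
      ennreal (?d * ?d) * return_measure M T \<alpha> \<phi> G \<psi> (cyl c) \<xi> n \<one>" .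
  qed
qed

text \<open>The growth rate is a limsup and is therefore attained along some subsequence; dropping
  its first \<open>m\<close> terms ensures \<open>m \<le> r i\<close>.\<close>

lemma spectral_radius_subsequence:
  assumes w: "w \<in> words \<alpha> m" and \<xi>: "\<xi> \<in> cyl w"
  shows "\<exists>r. strict_mono r \<and> (\<forall>i. m \<le> r i) \<and>
    (\<lambda>i. ennreal_log (spectral_radius G (return_measure M T \<alpha> \<phi> G \<psi> (cyl w) \<xi> (r i))) / ereal (real (r i)))
      \<longlonglongrightarrow> W.pressure"
proof -
  let ?m = "return_measure M T \<alpha> \<phi> G \<psi> (cyl w) \<xi>"
  let ?u = "\<lambda>n. ennreal_log (spectral_radius G (?m n)) / ereal (real n)"
  obtain C D where bounds: "C > 0" "\<And>n g. m \<le> n \<Longrightarrow> ?m n g \<le> ennreal C * W.Z n g"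
    "\<And>n. m \<le> n \<Longrightarrow> infsum p {v\<in>words \<alpha> n. take (length w) v = w \<and> word_val G \<theta> v = \<one>} \<le> ennreal D * ?m n \<one>"
    by (rule return_measure_bounds[OF w cyl_subset[OF \<xi>]]) (rule that)
  have "growth (\<lambda>n. spectral_radius G (?m n)) = W.pressure"
    by (rule W.growth_spectral_radius[OF words_lists[OF w] bounds(2) bounds(3) bounds(1)])
  then have "limsup ?u = W.pressure" by (simp add: growth_def)
  then obtain r where r: "strict_mono r" "(?u \<circ> r) \<longlonglongrightarrow> W.pressure"
    using limsup_subseq_lim[of ?u] by auto
  have "(?u \<circ> r \<circ> (\<lambda>i. i + m)) \<longlonglongrightarrow> W.pressure"
    using LIMSEQ_ignore_initial_segment[OF r(2), of m] by (simp add: comp_def)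
  moreover have "strict_mono (\<lambda>i. r (i + m))" using r(1) by (auto simp: strict_mono_def)
  moreover have "m \<le> r (i + m)" for i using seq_suble[OF r(1), of "i + m"] by simp
  ultimately show ?thesis by (intro exI[of _ "\<lambda>i. r (i + m)"]) (auto simp: comp_def)
qed

end

theorem proposition6p1:
  fixes M :: "'x measure" and T :: "'x \<Rightarrow> 'x" and \<alpha> :: "'x set set"
    and \<phi> :: "'x \<Rightarrow> real" and TX :: "'x topology"
    and G :: "('g, 'b) monoid_scheme" and \<psi> :: "'x \<Rightarrow> 'g"
  assumes gm: "gibbs_markov M T \<alpha> \<phi> TX"
    and full: "full_branches M T \<alpha>"
    and complete: "\<And>\<beta>. 0 < \<beta> \<Longrightarrow> \<beta> < 1 \<Longrightarrow>
      Metric_space.mcomplete (space M) (separation_dist T \<alpha> \<beta>)"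
    and G: "group G" "amenable G" "finitely_generated G"
    and \<psi>: "\<psi> \<in> space M \<rightarrow> carrier G" "\<And>a x y. a \<in> \<alpha> \<Longrightarrow> x \<in> a \<Longrightarrow> y \<in> a \<Longrightarrow> \<psi> x = \<psi> y"
    and transitive: "topologically_transitive (prod_topology TX (discrete_topology (carrier G)))
      (group_extension G T \<psi>)"
  shows "(\<forall>a\<in>\<alpha>. \<forall>b\<in>\<alpha>. \<forall>g\<in>carrier G. \<forall>k\<in>carrier (free_abelianization G).
      extension_pressure G T \<phi> \<psi> a g = ab_extension_pressure G T \<phi> \<psi> b k) \<and>
    (\<forall>m\<ge>1. \<forall>c\<in>cylinders (space M) T \<alpha> m. \<forall>\<xi>\<in>c.
      \<exists>(r :: nat \<Rightarrow> nat) (L :: ereal). strict_mono r \<and> (\<forall>i. m \<le> r i) \<and>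
        (\<lambda>i. ennreal_log (spectral_radius G (return_measure M T \<alpha> \<phi> G \<psi> c \<xi> (r i))) / ereal (real (r i)))
          \<longlonglongrightarrow> L \<and>
        (\<forall>a\<in>\<alpha>. \<forall>b\<in>\<alpha>. \<forall>g\<in>carrier G.
          extension_pressure G T \<phi> \<psi> a g = L + base_pressure T \<phi> b))"
proof -
  interpret full_gibbs_markov_extension M T \<alpha> \<phi> TX G \<psi>
    by (intro full_gibbs_markov_extension.intro full_gibbs_markov.intro
        full_gibbs_markov_axioms.intro full_gibbs_markov_extension_axioms.intro
        gm G(1) full complete \<psi> transitive)
  show ?thesis
  proof (intro conjI ballI allI impI)
    fix a b g k
    assume "a \<in> \<alpha>" "b \<in> \<alpha>" "g \<in> carrier G" "k \<in> carrier (free_abelianization G)"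
    then show "extension_pressure G T \<phi> \<psi> a g = ab_extension_pressure G T \<phi> \<psi> b k"
      by (simp add: extension_pressure_eq ab_extension_pressure_eq G(2))
  next
    fix m c \<xi>
    assume "c \<in> cylinders (space M) T \<alpha> m" and \<xi>: "\<xi> \<in> c"
    then obtain w where w: "w \<in> words \<alpha> m" "c = cyl w" using cylinders_eq by auto
    obtain r where r: "strict_mono r" "\<forall>i. m \<le> r i"
      "(\<lambda>i. ennreal_log (spectral_radius G (return_measure M T \<alpha> \<phi> G \<psi> c \<xi> (r i))) / ereal (real (r i)))
        \<longlonglongrightarrow> W.pressure"
      using spectral_radius_subsequence[OF w(1), of \<xi>] \<xi> unfolding w(2) by blast
    \<comment> \<open>The limit \<open>L\<close> is the common pressure of the extension, and the
      base pressure is 0.\<close>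
    have "\<forall>a\<in>\<alpha>. \<forall>b\<in>\<alpha>. \<forall>g\<in>carrier G.
        extension_pressure G T \<phi> \<psi> a g = W.pressure + base_pressure T \<phi> b"
      by (simp add: extension_pressure_eq base_pressure_eq)
    with r show "\<exists>(r :: nat \<Rightarrow> nat) (L :: ereal). strict_mono r \<and> (\<forall>i. m \<le> r i) \<and>
        (\<lambda>i. ennreal_log (spectral_radius G (return_measure M T \<alpha> \<phi> G \<psi> c \<xi> (r i))) / ereal (real (r i)))
          \<longlonglongrightarrow> L \<and>
        (\<forall>a\<in>\<alpha>. \<forall>b\<in>\<alpha>. \<forall>g\<in>carrier G.
          extension_pressure G T \<phi> \<psi> a g = L + base_pressure T \<phi> b)"
      by blast
  qed
qed

end
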